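(* Over $\mathsf{RCA}_0^\omega$ there is an explicit equivalence $\mathsf{UADS}_2\leftrightarrow(\mu^2)$, where $\mathsf{UADS}_2$ is the statement: there is $\Phi^{3}$ such that for all linear orders $X^{1}$ and all $g^{2}$, $$(\forall x_{(\cdot)}^{1}\in \mathrm{Seq}(X))(\exists n^{0}, k^{0}\leq g(x_{(\cdot)}))\big(x_{n}\leq_{X} x_{n+1} \wedge x_{k}\geq_{X} x_{k+1}\big)$$ implies $$(\forall m^{0}\in \mathrm{field}(X))\big(\Phi(X,g)(1)\leq_{X}m\leq_{X} \Phi(X,g)(2)\big).$$
   Context: Types: $0$ is the type of natural numbers, $1=0\to 0$, $2=1\to 0$, $3$ stands for functionals taking type-2 (and lower) inputs. Sets of naturals are type-1 objects given by binary characteristic functions. $\mathsf{RCA}_0^\omega$ is Kohlenbach's base theory $\mathsf{E}\text{-}\mathsf{PRA}^\omega+\mathsf{QF}\text{-}\mathsf{AC}^{1,0}$: $\mathsf{E}\text{-}\mathsf{PRA}^\omega$ is classical extensional primitive recursive arithmetic in all finite types (combinators, recursor for type 0 only, quantifier-free induction, and the full extensionality axiom), and $\mathsf{QF}\text{-}\mathsf{AC}^{1,0}$ is $(\forall f^1)(\exists n^0)\varphi_0(f,n)\to(\exists F^2)(\forall f^1)\varphi_0(f,F(f))$ for quantifier-free $\varphi_0$. $(\mu^2)$ is $(\exists\mu^2)(\forall f^1)[(\exists n^0)f(n)=0\to f(\mu(f))=0]$. A linear order $X^1$ is coded as a reflexive order given by a set of pairs: $i\le_X j$ iff $(i,j)\in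 X$, $\mathrm{field}(X)=\{i:(i,i)\in X\}$, and $x\le_Xy\wedge y\le_Xx$ implies $x=_0y$. $\mathrm{Seq}(X)$ is the collection of infinite sequences $x_0,x_1,\dots$ of elements of $\mathrm{field}(X)$. $\Phi(X,g)$ is a pair of natural numbers with components $\Phi(X,g)(1)$, $\Phi(X,g)(2)$. An implication $(\exists \Phi)A(\Phi)\to(\exists\Psi)B(\Psi)$ is explicit if there is a term $t$ of the language such that additionally $(\forall\Phi)[A(\Phi)\to B(t(\Phi))]$ is provable. By convention the implication is still called explicit if $t$ takes as an additional argument an extensionality functional for $\Phi$, i.e. a functional $\Xi$ witnessing the extensionality of $\Phi$: for type-1 inputs, $(\forall k^0,f^1,g^1)[\overline f\,\Xi(f,g,k)=\overline g\,\Xi(f,g,k)\to\overline{\Phi(f)}k=\overline{\Phi(g)}k]$, where $\overline f n$ is the initial segment of $f$ of length $n$; here the relevant extensionality is with respect to the type-1 argument $X$, with $g$ as a parameter. An explicit equivalence is a provable equivalence both of whose implications are explicit. *)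

theory Defs
  imports Main
begin

section \<open>The language of arithmetic in all finite types\<close>

datatype ty = Tp0 | Arr ty ty (infixr "\<rightarrow>" 60)

abbreviation Tp1 :: ty where "Tp1 \<equiv> Tp0 \<rightarrow> Tp0"
abbreviation Tp2 :: ty where "Tp2 \<equiv> Tp1 \<rightarrow> Tp0"

text \<open>Every type has its own countable supply of variables.\<close>

type_synonym var = "string \<times> ty"

text \<open>
  Formulas are locally nameless: a free variable is a named typed variable \<open>FVar\<close>, a bound
  variable is a de Bruijn index \<open>BVar\<close>. There is no abstraction in terms, so only the
  quantifier of formulas binds. The constants \<open>CK\<close> and \<open>CS\<close> are the combinators
  (often written $\Pi$ and $\Sigma$), indexed by types.
\<close>

datatype tm =
    FVar var
  | BVar nat
  | Zero
  | Sc
  | CK ty ty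
  | CS ty ty ty
  | R0
  | App tm tm (infixl "\<cdot>" 100)

text \<open>
  The only prime formulas are equations between terms of type 0; the logic is classical, and the
  remaining connectives are abbreviations.
\<close>

datatype fm =
    Bot
  | Eq tm tm (infix "\<^bold>=" 60)
  | Imp fm fm (infixr "\<^bold>\<longrightarrow>" 45)
  | Forall ty fm

abbreviation Neg :: "fm \<Rightarrow> fm" ("\<^bold>\<not> _" [55] 55) where
  "\<^bold>\<not> p \<equiv> p \<^bold>\<longrightarrow> Bot"
abbreviation Con :: "fm \<Rightarrow> fm \<Rightarrow> fm" (infixr "\<^bold>\<and>" 52) where
  "p \<^bold>\<and> q \<equiv> \<^bold>\<not> (p \<^bold>\<longrightarrow> \<^bold>\<not> q)"
abbreviation Dis :: "fm \<Rightarrow> fm \<Rightarrow> fm" (infixr "\<^bold>\<or>" 50) where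
  "p \<^bold>\<or> q \<equiv> \<^bold>\<not> p \<^bold>\<longrightarrow> q"
abbreviation Iff :: "fm \<Rightarrow> fm \<Rightarrow> fm" (infix "\<^bold>\<longleftrightarrow>" 43) where
  "p \<^bold>\<longleftrightarrow> q \<equiv> (p \<^bold>\<longrightarrow> q) \<^bold>\<and> (q \<^bold>\<longrightarrow> p)"

primrec has_ty :: "ty list \<Rightarrow> tm \<Rightarrow> ty \<Rightarrow> bool" where
  "has_ty D (FVar v) r \<longleftrightarrow> r = snd v"
| "has_ty D (BVar i) r \<longleftrightarrow> i < length D \<and> r = D ! i"
| "has_ty D Zero r \<longleftrightarrow> r = Tp0"
| "has_ty D Sc r \<longleftrightarrow> r = Tp0 \<rightarrow> Tp0"
| "has_ty D (CK a b) r \<longleftrightarrow> r = a \<rightarrow> b \<rightarrow> a"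
| "has_ty D (CS a b c) r \<longleftrightarrow> r = (a \<rightarrow> b \<rightarrow> c) \<rightarrow> (a \<rightarrow> b) \<rightarrow> a \<rightarrow> c"
| "has_ty D R0 r \<longleftrightarrow> r = Tp0 \<rightarrow> Tp0 \<rightarrow> (Tp0 \<rightarrow> Tp0 \<rightarrow> Tp0) \<rightarrow> Tp0"
| "has_ty D (s \<cdot> t) r \<longleftrightarrow> (\<exists>a. has_ty D s (a \<rightarrow> r) \<and> has_ty D t a)"

text \<open>
  The list holds the types of the dangling indices; \<open>has_ty []\<close> and \<open>wff []\<close> thus mean
  well typed and without dangling index, but possibly with free named variables.
\<close>

primrec wff :: "ty list \<Rightarrow> fm \<Rightarrow> bool" where
  "wff D Bot \<longleftrightarrow> True"
| "wff D (s \<^bold>= t) \<longleftrightarrow> has_ty D s Tp0 \<and> has_ty D t Tp0"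
| "wff D (p \<^bold>\<longrightarrow> q) \<longleftrightarrow> wff D p \<and> wff D q"
| "wff D (Forall r p) \<longleftrightarrow> wff (r # D) p"

primrec fv_tm :: "tm \<Rightarrow> var set" where
  "fv_tm (FVar v) = {v}"
| "fv_tm (BVar i) = {}"
| "fv_tm Zero = {}"
| "fv_tm Sc = {}"
| "fv_tm (CK a b) = {}"
| "fv_tm (CS a b c) = {}"
| "fv_tm R0 = {}"
| "fv_tm (s \<cdot> t) = fv_tm s \<union> fv_tm t"

primrec fv :: "fm \<Rightarrow> var set" where
  "fv Bot = {}"
| "fv (s \<^bold>= t) = fv_tm s \<union> fv_tm t"
| "fv (p \<^bold>\<longrightarrow> q) = fv p \<union> fv q"
| "fv (Forall r p) = fv p"

primrec qf :: "fm \<Rightarrow> bool" where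
  "qf Bot \<longleftrightarrow> True"
| "qf (s \<^bold>= t) \<longleftrightarrow> True"
| "qf (p \<^bold>\<longrightarrow> q) \<longleftrightarrow> qf p \<and> qf q"
| "qf (Forall r p) \<longleftrightarrow> False"

primrec inst_tm :: "nat \<Rightarrow> tm \<Rightarrow> tm \<Rightarrow> tm" where
  "inst_tm k u (FVar v) = FVar v"
| "inst_tm k u (BVar i) = (if i = k then u else BVar i)"
| "inst_tm k u Zero = Zero"
| "inst_tm k u Sc = Sc"
| "inst_tm k u (CK a b) = CK a b"
| "inst_tm k u (CS a b c) = CS a b c"
| "inst_tm k u R0 = R0"
| "inst_tm k u (s \<cdot> t) = inst_tm k u s \<cdot> inst_tm k u t"

text \<open>
  Instantiation is only ever used for terms \<open>u\<close> without dangling indices, so that nothing can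
  be captured and \<open>u\<close> need not be lifted under quantifiers.
\<close>

primrec inst :: "nat \<Rightarrow> tm \<Rightarrow> fm \<Rightarrow> fm" where
  "inst k u Bot = Bot"
| "inst k u (s \<^bold>= t) = (inst_tm k u s \<^bold>= inst_tm k u t)"
| "inst k u (p \<^bold>\<longrightarrow> q) = (inst k u p \<^bold>\<longrightarrow> inst k u q)"
| "inst k u (Forall r p) = Forall r (inst (Suc k) u p)"

primrec close_tm :: "nat \<Rightarrow> var \<Rightarrow> tm \<Rightarrow> tm" where
  "close_tm k v (FVar w) = (if w = v then BVar k else FVar w)"
| "close_tm k v (BVar i) = BVar i"
| "close_tm k v Zero = Zero"
| "close_tm k v Sc = Sc"
| "close_tm k v (CK a b) = CK a b"
| "close_tm k v (CS a b c) = CS a b c"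
| "close_tm k v R0 = R0"
| "close_tm k v (s \<cdot> t) = close_tm k v s \<cdot> close_tm k v t"

primrec close :: "nat \<Rightarrow> var \<Rightarrow> fm \<Rightarrow> fm" where
  "close k v Bot = Bot"
| "close k v (s \<^bold>= t) = (close_tm k v s \<^bold>= close_tm k v t)"
| "close k v (p \<^bold>\<longrightarrow> q) = (close k v p \<^bold>\<longrightarrow> close k v q)"
| "close k v (Forall r p) = Forall r (close (Suc k) v p)"

text \<open>Quantification over, and substitution for, a named free variable.\<close>

definition all_var :: "var \<Rightarrow> fm \<Rightarrow> fm" ("(\<^bold>\<forall>_./ _)" [0, 42] 42) where
  "(\<^bold>\<forall>v. p) = Forall (snd v) (close 0 v p)"

definition ex_var :: "var \<Rightarrow> fm \<Rightarrow> fm" ("(\<^bold>\<exists>_./ _)" [0, 42] 42) where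
  "(\<^bold>\<exists>v. p) = \<^bold>\<not> (\<^bold>\<forall>v. \<^bold>\<not> p)"

definition subst :: "fm \<Rightarrow> var \<Rightarrow> tm \<Rightarrow> fm" where
  "subst p v t = inst 0 t (close 0 v p)"

text \<open>Equality of higher type is not primitive: it abbreviates extensional equality.\<close>

primrec lift :: "tm \<Rightarrow> tm" where
  "lift (FVar v) = FVar v"
| "lift (BVar i) = BVar (Suc i)"
| "lift Zero = Zero"
| "lift Sc = Sc"
| "lift (CK a b) = CK a b"
| "lift (CS a b c) = CS a b c"
| "lift R0 = R0"
| "lift (s \<cdot> t) = lift s \<cdot> lift t"

primrec eq_at :: "ty \<Rightarrow> tm \<Rightarrow> tm \<Rightarrow> fm" where
  "eq_at Tp0 s t = (s \<^bold>= t)"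
| "eq_at (a \<rightarrow> b) s t = Forall a (eq_at b (lift s \<cdot> BVar 0) (lift t \<cdot> BVar 0))"


section \<open>Provability\<close>

text \<open>
  Classical natural deduction over a set \<open>T\<close> of axioms. A free variable of an axiom is read
  as universally quantified, hence the eigenvariable condition only concerns \<open>G\<close>.
\<close>

inductive deriv :: "fm set \<Rightarrow> fm list \<Rightarrow> fm \<Rightarrow> bool" for T :: "fm set" where
  Axiom: "p \<in> T \<Longrightarrow> wff [] p \<Longrightarrow> deriv T G p"
| Assm: "p \<in> set G \<Longrightarrow> wff [] p \<Longrightarrow> deriv T G p"
| ImpI: "wff [] p \<Longrightarrow> deriv T (p # G) q \<Longrightarrow> deriv T G (p \<^bold>\<longrightarrow> q)"
| ImpE: "deriv T G (p \<^bold>\<longrightarrow> q) \<Longrightarrow> deriv T G p \<Longrightarrow> deriv T G q"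
| Classical: "wff [] p \<Longrightarrow> deriv T ((\<^bold>\<not> p) # G) Bot \<Longrightarrow> deriv T G p"
| ForallI: "deriv T G (inst 0 (FVar v) p) \<Longrightarrow> snd v = r \<Longrightarrow>
    v \<notin> fv p \<Longrightarrow> (\<forall>q \<in> set G. v \<notin> fv q) \<Longrightarrow> deriv T G (Forall r p)"
| ForallE: "deriv T G (Forall r p) \<Longrightarrow> has_ty [] t r \<Longrightarrow> deriv T G (inst 0 t p)"

abbreviation provable :: "fm set \<Rightarrow> fm \<Rightarrow> bool" (infix "\<turnstile>" 40) where
  "T \<turnstile> p \<equiv> deriv T [] p"


section \<open>The base theory\<close>

inductive_set EPRA :: "fm set" where
  eq_refl: "has_ty [] s Tp0 \<Longrightarrow> (s \<^bold>= s) \<in> EPRA"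
| eq_sym: "has_ty [] s Tp0 \<Longrightarrow> has_ty [] t Tp0 \<Longrightarrow> (s \<^bold>= t \<^bold>\<longrightarrow> t \<^bold>= s) \<in> EPRA"
| eq_trans: "has_ty [] s Tp0 \<Longrightarrow> has_ty [] t Tp0 \<Longrightarrow> has_ty [] u Tp0 \<Longrightarrow>
    (s \<^bold>= t \<^bold>\<longrightarrow> t \<^bold>= u \<^bold>\<longrightarrow> s \<^bold>= u) \<in> EPRA"
| extensionality: "has_ty [] z (a \<rightarrow> b) \<Longrightarrow> has_ty [] s a \<Longrightarrow> has_ty [] t a \<Longrightarrow>
    (eq_at a s t \<^bold>\<longrightarrow> eq_at b (z \<cdot> s) (z \<cdot> t)) \<in> EPRA"
| Sc_not_Zero: "has_ty [] s Tp0 \<Longrightarrow> (\<^bold>\<not> (Sc \<cdot> s \<^bold>= Zero)) \<in> EPRA"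
| Sc_inject: "has_ty [] s Tp0 \<Longrightarrow> has_ty [] t Tp0 \<Longrightarrow>
    (Sc \<cdot> s \<^bold>= Sc \<cdot> t \<^bold>\<longrightarrow> s \<^bold>= t) \<in> EPRA"
| CK: "has_ty [] s a \<Longrightarrow> has_ty [] t b \<Longrightarrow> eq_at a (CK a b \<cdot> s \<cdot> t) s \<in> EPRA"
| CS: "has_ty [] s (a \<rightarrow> b \<rightarrow> c) \<Longrightarrow> has_ty [] t (a \<rightarrow> b) \<Longrightarrow> has_ty [] u a \<Longrightarrow>
    eq_at c (CS a b c \<cdot> s \<cdot> t \<cdot> u) (s \<cdot> u \<cdot> (t \<cdot> u)) \<in> EPRA"
| R0_Zero: "has_ty [] s Tp0 \<Longrightarrow> has_ty [] z (Tp0 \<rightarrow> Tp0 \<rightarrow> Tp0) \<Longrightarrow>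
    (R0 \<cdot> Zero \<cdot> s \<cdot> z \<^bold>= s) \<in> EPRA"
| R0_Sc: "has_ty [] n Tp0 \<Longrightarrow> has_ty [] s Tp0 \<Longrightarrow> has_ty [] z (Tp0 \<rightarrow> Tp0 \<rightarrow> Tp0) \<Longrightarrow>
    (R0 \<cdot> (Sc \<cdot> n) \<cdot> s \<cdot> z \<^bold>= z \<cdot> (R0 \<cdot> n \<cdot> s \<cdot> z) \<cdot> n) \<in> EPRA"
| qf_induction: "qf p \<Longrightarrow> wff [] p \<Longrightarrow> n = (a, Tp0) \<Longrightarrow>
    (subst p n Zero \<^bold>\<and> (\<^bold>\<forall>n. p \<^bold>\<longrightarrow> subst p n (Sc \<cdot> FVar n)) \<^bold>\<longrightarrow> (\<^bold>\<forall>n. p)) \<in> EPRA"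

inductive_set QF_AC10 :: "fm set" where
  "qf p \<Longrightarrow> wff [] p \<Longrightarrow> f = (a, Tp1) \<Longrightarrow> n = (b, Tp0) \<Longrightarrow> F = (c, Tp2) \<Longrightarrow> F \<notin> fv p \<Longrightarrow>
    ((\<^bold>\<forall>f. \<^bold>\<exists>n. p) \<^bold>\<longrightarrow> (\<^bold>\<exists>F. \<^bold>\<forall>f. subst p n (FVar F \<cdot> FVar f))) \<in> QF_AC10"

definition RCA0_omega :: "fm set" where
  "RCA0_omega = EPRA \<union> QF_AC10"


section \<open>Explicit implications and equivalences\<close>

text \<open>
  The functional whose existence is asserted by \<open>\<^bold>\<exists>P. A\<close> is named by the variable \<open>P\<close>. The
  formula \<open>E\<close> expresses that \<open>X\<close> is an extensionality functional for \<open>P\<close>; the realising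
  term may, but need not, use such an \<open>X\<close>.
\<close>

definition explicit_imp ::
  "fm set \<Rightarrow> var \<Rightarrow> fm \<Rightarrow> var \<Rightarrow> fm \<Rightarrow> var \<Rightarrow> fm \<Rightarrow> bool" where
  "explicit_imp T P A X E Q B \<longleftrightarrow>
     (T \<turnstile> (\<^bold>\<exists>P. A) \<^bold>\<longrightarrow> (\<^bold>\<exists>Q. B)) \<and>
     ((\<exists>t. has_ty [] t (snd P \<rightarrow> snd Q) \<and> fv_tm t = {} \<and>
           (T \<turnstile> \<^bold>\<forall>P. A \<^bold>\<longrightarrow> subst B Q (t \<cdot> FVar P))) \<or>
      (\<exists>t. has_ty [] t (snd P \<rightarrow> snd X \<rightarrow> snd Q) \<and> fv_tm t = {} \<and>
           (T \<turnstile> \<^bold>\<forall>P. \<^bold>\<forall>X. A \<^bold>\<and> E \<^bold>\<longrightarrow> subst B Q (t \<cdot> FVar P \<cdot> FVar X))))"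

definition explicit_equiv ::
  "fm set \<Rightarrow> var \<Rightarrow> fm \<Rightarrow> var \<Rightarrow> fm \<Rightarrow> var \<Rightarrow> fm \<Rightarrow> var \<Rightarrow> fm \<Rightarrow> bool" where
  "explicit_equiv T P A X E Q B Y F \<longleftrightarrow>
     (T \<turnstile> (\<^bold>\<exists>P. A) \<^bold>\<longleftrightarrow> (\<^bold>\<exists>Q. B)) \<and>
     explicit_imp T P A X E Q B \<and> explicit_imp T Q B Y F P A"


section \<open>Elementary notions inside the language\<close>

text \<open>Abstraction is definable from the combinators (bracket abstraction).\<close>

primrec ty_of :: "tm \<Rightarrow> ty" where
  "ty_of (FVar v) = snd v"
| "ty_of (BVar i) = Tp0"
| "ty_of Zero = Tp0"
| "ty_of Sc = Tp1"
| "ty_of (CK a b) = a \<rightarrow> b \<rightarrow> a"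
| "ty_of (CS a b c) = (a \<rightarrow> b \<rightarrow> c) \<rightarrow> (a \<rightarrow> b) \<rightarrow> a \<rightarrow> c"
| "ty_of R0 = Tp0 \<rightarrow> Tp0 \<rightarrow> (Tp0 \<rightarrow> Tp0 \<rightarrow> Tp0) \<rightarrow> Tp0"
| "ty_of (s \<cdot> t) = (case ty_of s of a \<rightarrow> b \<Rightarrow> b | Tp0 \<Rightarrow> Tp0)"

primrec lam :: "var \<Rightarrow> tm \<Rightarrow> tm" where
  "lam v (FVar w) =
     (if w = v then CS (snd v) (snd v \<rightarrow> snd v) (snd v) \<cdot> CK (snd v) (snd v \<rightarrow> snd v) \<cdot> CK (snd v) (snd v)
      else CK (snd w) (snd v) \<cdot> FVar w)"
| "lam v (BVar i) = CK Tp0 (snd v) \<cdot> BVar i"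
| "lam v Zero = CK Tp0 (snd v) \<cdot> Zero"
| "lam v Sc = CK Tp1 (snd v) \<cdot> Sc"
| "lam v (CK a b) = CK (ty_of (CK a b)) (snd v) \<cdot> CK a b"
| "lam v (CS a b c) = CK (ty_of (CS a b c)) (snd v) \<cdot> CS a b c"
| "lam v R0 = CK (ty_of R0) (snd v) \<cdot> R0"
| "lam v (s \<cdot> t) = CS (snd v) (ty_of t) (ty_of (s \<cdot> t)) \<cdot> lam v s \<cdot> lam v t"

abbreviation v0 :: "string \<Rightarrow> var" where "v0 a \<equiv> (a, Tp0)"

abbreviation One :: tm where "One \<equiv> Sc \<cdot> Zero"

text \<open>
  In the recursions below, \<open>''r''\<close> is the previous value and \<open>''i''\<close> the recursion
  index. The step terms are closed terms.
\<close>

definition add :: "tm \<Rightarrow> tm \<Rightarrow> tm" where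
  "add s t = R0 \<cdot> s \<cdot> t \<cdot> lam (v0 ''r'') (lam (v0 ''i'') (Sc \<cdot> FVar (v0 ''r'')))"

definition pred :: "tm \<Rightarrow> tm" where
  "pred s = R0 \<cdot> s \<cdot> Zero \<cdot> lam (v0 ''r'') (lam (v0 ''i'') (FVar (v0 ''i'')))"

definition monus :: "tm \<Rightarrow> tm \<Rightarrow> tm" where
  "monus s t = R0 \<cdot> t \<cdot> s \<cdot> lam (v0 ''r'') (lam (v0 ''i'') (pred (FVar (v0 ''r''))))"

definition leq :: "tm \<Rightarrow> tm \<Rightarrow> fm" where
  "leq s t = (monus s t \<^bold>= Zero)"

definition tri :: "tm \<Rightarrow> tm" where
  "tri s = R0 \<cdot> s \<cdot> Zero \<cdot>
     lam (v0 ''r'') (lam (v0 ''i'') (Sc \<cdot> add (FVar (v0 ''r'')) (FVar (v0 ''i''))))"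

text \<open>Cantor's pairing function, $(i,j) \mapsto (i+j)(i+j+1)/2 + i$.\<close>

definition pair :: "tm \<Rightarrow> tm \<Rightarrow> tm" where
  "pair s t = add (tri (add s t)) s"

text \<open>
  The formulas below bind the names \<open>''i''\<close>, \<open>''j''\<close>, \<open>''k''\<close> of type 0 and must
  only be applied to terms in which these do not occur.
\<close>

text \<open>Equality of the initial segments of length \<open>k\<close> of two sequences.\<close>

definition agree :: "tm \<Rightarrow> tm \<Rightarrow> tm \<Rightarrow> fm" where
  "agree f h k = (\<^bold>\<forall>v0 ''i''. leq (Sc \<cdot> FVar (v0 ''i'')) k \<^bold>\<longrightarrow>
     f \<cdot> FVar (v0 ''i'') \<^bold>= h \<cdot> FVar (v0 ''i''))"

text \<open>Sets of naturals are type-1 objects taking only the values 0 and 1.\<close>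

definition is_set :: "tm \<Rightarrow> fm" where
  "is_set X = (\<^bold>\<forall>v0 ''i''. X \<cdot> FVar (v0 ''i'') \<^bold>= Zero \<^bold>\<or> X \<cdot> FVar (v0 ''i'') \<^bold>= One)"

definition rel :: "tm \<Rightarrow> tm \<Rightarrow> tm \<Rightarrow> fm" where
  "rel X s t = (X \<cdot> pair s t \<^bold>= One)"

definition in_field :: "tm \<Rightarrow> tm \<Rightarrow> fm" where
  "in_field X s = rel X s s"

definition lin_order :: "tm \<Rightarrow> fm" where
  "lin_order X =
     (let i = v0 ''i''; j = v0 ''j''; k = v0 ''k'';
          le = (\<lambda>a b. rel X (FVar a) (FVar b)); field = (\<lambda>a. in_field X (FVar a)) in
      is_set X \<^bold>\<and>
      (\<^bold>\<forall>i. \<^bold>\<forall>j. le i j \<^bold>\<longrightarrow> field i \<^bold>\<and> field j) \<^bold>\<and>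
      (\<^bold>\<forall>i. \<^bold>\<forall>j. \<^bold>\<forall>k. le i j \<^bold>\<and> le j k \<^bold>\<longrightarrow> le i k) \<^bold>\<and>
      (\<^bold>\<forall>i. \<^bold>\<forall>j. le i j \<^bold>\<and> le j i \<^bold>\<longrightarrow> FVar i \<^bold>= FVar j) \<^bold>\<and>
      (\<^bold>\<forall>i. \<^bold>\<forall>j. field i \<^bold>\<and> field j \<^bold>\<longrightarrow> le i j \<^bold>\<or> le j i))"

text \<open>\<open>x\<close> is an infinite sequence of elements of the field of \<open>X\<close>.\<close>

definition in_Seq :: "tm \<Rightarrow> tm \<Rightarrow> fm" where
  "in_Seq X x = (\<^bold>\<forall>v0 ''i''. in_field X (x \<cdot> FVar (v0 ''i'')))"


section \<open>The two principles\<close>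

definition var_mu :: var where "var_mu = (''mu'', Tp2)"

definition mu_spec :: fm where
  "mu_spec =
     (let f = (''f'', Tp1); n = v0 ''n'' in
      \<^bold>\<forall>f. (\<^bold>\<exists>n. FVar f \<cdot> FVar n \<^bold>= Zero) \<^bold>\<longrightarrow> FVar f \<cdot> (FVar var_mu \<cdot> FVar f) \<^bold>= Zero)"

definition var_Phi :: var where "var_Phi = (''Phi'', Tp1 \<rightarrow> Tp2 \<rightarrow> Tp0)"

text \<open>
  The value of \<open>\<Phi>\<close> at \<open>X\<close>, \<open>g\<close> is the code of a pair, with components \<open>a\<close>, \<open>b\<close>.
\<close>

definition UADS2_spec :: fm where
  "UADS2_spec =
     (let X = (''X'', Tp1); g = (''g'', Tp2); x = (''x'', Tp1);
          n = v0 ''n''; k = v0 ''k''; m = v0 ''m''; a = v0 ''a''; b = v0 ''b'' in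
      \<^bold>\<forall>X. \<^bold>\<forall>g. lin_order (FVar X) \<^bold>\<longrightarrow>
        (\<^bold>\<forall>x. in_Seq (FVar X) (FVar x) \<^bold>\<longrightarrow>
          (\<^bold>\<exists>n. \<^bold>\<exists>k. leq (FVar n) (FVar g \<cdot> FVar x) \<^bold>\<and> leq (FVar k) (FVar g \<cdot> FVar x) \<^bold>\<and>
             rel (FVar X) (FVar x \<cdot> FVar n) (FVar x \<cdot> (Sc \<cdot> FVar n)) \<^bold>\<and>
             rel (FVar X) (FVar x \<cdot> (Sc \<cdot> FVar k)) (FVar x \<cdot> FVar k))) \<^bold>\<longrightarrow>
        (\<^bold>\<exists>a. \<^bold>\<exists>b. FVar var_Phi \<cdot> FVar X \<cdot> FVar g \<^bold>= pair (FVar a) (FVar b) \<^bold>\<and>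
           (\<^bold>\<forall>m. in_field (FVar X) (FVar m) \<^bold>\<longrightarrow>
              rel (FVar X) (FVar a) (FVar m) \<^bold>\<and> rel (FVar X) (FVar m) (FVar b))))"

text \<open>
  Extensionality functionals. The values of \<open>\<mu>\<close> and \<open>\<Phi>\<close> are numbers, so these do not
  depend on a length up to which the values are to agree. For \<open>\<Phi>\<close> they witness
  extensionality in the set argument, the type-2 argument being a parameter.
\<close>

definition var_Xi_mu :: var where "var_Xi_mu = (''Xi'', Tp1 \<rightarrow> Tp1 \<rightarrow> Tp0)"

definition mu_ext :: fm where
  "mu_ext =
     (let f = (''f'', Tp1); h = (''h'', Tp1) in
      \<^bold>\<forall>f. \<^bold>\<forall>h. agree (FVar f) (FVar h) (FVar var_Xi_mu \<cdot> FVar f \<cdot> FVar h) \<^bold>\<longrightarrow>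
        FVar var_mu \<cdot> FVar f \<^bold>= FVar var_mu \<cdot> FVar h)"

definition var_Xi_Phi :: var where "var_Xi_Phi = (''Xi'', Tp1 \<rightarrow> Tp1 \<rightarrow> Tp2 \<rightarrow> Tp0)"

definition UADS2_ext :: fm where
  "UADS2_ext =
     (let X = (''X'', Tp1); Y = (''Y'', Tp1); g = (''g'', Tp2) in
      \<^bold>\<forall>X. \<^bold>\<forall>Y. \<^bold>\<forall>g. agree (FVar X) (FVar Y) (FVar var_Xi_Phi \<cdot> FVar X \<cdot> FVar Y \<cdot> FVar g) \<^bold>\<longrightarrow>
        FVar var_Phi \<cdot> FVar X \<cdot> FVar g \<^bold>= FVar var_Phi \<cdot> FVar Y \<cdot> FVar g)"

end

theory Submission
  imports Defs "HOL-Library.Countable"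
begin

text \<open>
  From \<open>\<Phi>\<close> to \<open>\<mu>\<close>: given \<open>f\<close>, order \<open>{0, c + 1}\<close> by \<open>0 < c + 1\<close> if \<open>c\<close> is the least zero of \<open>f\<close>, and
  take the one-element order on \<open>{0}\<close> if there is no zero. In an order with at most two elements
  every sequence has a weak ascent and a weak descent among its first two steps, so the constant
  functional 1 is an admissible \<open>g\<close>. If \<open>f\<close> has a zero, the greatest element is \<open>c + 1\<close>, and it is
  bounded by the pair \<open>\<Phi>\<close> returns; hence the least zero of \<open>f\<close> is found by a search below that
  number.

  From \<open>\<mu>\<close> to \<open>\<Phi>\<close>: being the least element of \<open>X\<close> is decided by \<open>\<mu>\<close>, which also finds such an
  element if there is one. If there is none, then iterating a choice of smaller elements (given by
  \<open>\<mu>\<close>) yields a strictly descending sequence, which contradicts the assumption on \<open>g\<close>; dually for the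
  greatest element.

  Provability is obtained from a Henkin completeness theorem: it suffices to argue in typed
  applicative structures in which equality at higher types is extensional and induction holds for
  quantifier-free predicates with parameters.
\<close>

section \<open>Syntax and provability\<close>

text \<open>Two obstacles shape the proof. Models may have nonstandard numbers and offer induction
  only for Boolean combinations of equations, so existential facts of arithmetic are inducted on in
  a form where predecessor or truncated subtraction supplies the witness. And the order built from
  \<open>f\<close> must be a term in \<open>f\<close>, although no such term decides whether
  \<open>f\<close> has a zero. The way out is that the pairing code of \<open>(s, c + 1)\<close> is
  at least \<open>c + 1\<close>: whether a code lies in the order is settled by searching for a zero
  of \<open>f\<close> only up to that code. The same inequality lets the code returned by \<Phi>
  serve as a search bound without being decoded. The shift from \<open>c\<close> to
  \<open>c + 1\<close> keeps the second point distinct from \<open>0\<close>. In the other direction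
  \<mu> is nested: an inner use looks for an element refuting that \<open>a\<close> is least, which
  makes being least decidable, and an outer use searches for a least element. The iteration giving a
  descending sequence fits the type-0 recursor because its values are numbers.\<close>

instance ty :: countable by countable_datatype
instance char :: countable by (rule countable_classI[of of_char]) simp
instance tm :: countable by countable_datatype
instance fm :: countable by countable_datatype

section \<open>Typing under instantiation and closing of variables\<close>

lemma has_ty_unique: "has_ty D t a \<Longrightarrow> has_ty D t b \<Longrightarrow> a = b"
proof (induction t arbitrary: a b)
  case (App s t)
  then show ?case by (metis has_ty.simps(8) ty.inject)
qed auto

lemma has_ty_append: "has_ty D t a \<Longrightarrow> has_ty (D @ E) t a"
  by (induction t arbitrary: a) (auto simp: nth_append)

text \<open>The instantiated index is the outermost one: \<open>inst\<close> raises its index under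
  each quantifier while contexts grow at the front, so the type \<open>a\<close> stays at the end of
  the list, at position \<open>length D\<close>. The same shape recurs in all substitution
  lemmas.\<close>

lemma has_ty_inst:
  "has_ty (D @ [a]) t b \<Longrightarrow> has_ty [] u a \<Longrightarrow> has_ty D (inst_tm (length D) u t) b"
  using has_ty_append[of "[]" u a D]
  by (induction t arbitrary: b) (auto simp: nth_append split: if_splits)

lemma wff_inst: "wff (D @ [a]) p \<Longrightarrow> has_ty [] u a \<Longrightarrow> wff D (inst (length D) u p)"
proof (induction p arbitrary: D)
  case (Forall r p)
  then show ?case using Forall.IH[of "r # D"] by simp
qed (auto intro: has_ty_inst)

lemma wff_inst0: "wff [a] p \<Longrightarrow> has_ty [] u a \<Longrightarrow> wff [] (inst 0 u p)"
  using wff_inst[of "[]"] by simp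

text \<open>Typing of a body is recovered from its opened instance, which \<open>deriv_wff\<close>
  relies on because the rule \<open>ForallI\<close> has no well-formedness premise.\<close>

lemma has_ty_inst_FVar:
  "has_ty D (inst_tm (length D) (FVar v) t) b \<Longrightarrow> has_ty (D @ [snd v]) t b"
  by (induction t arbitrary: b) (auto simp: nth_append split: if_splits)

lemma wff_inst_FVar: "wff D (inst (length D) (FVar v) p) \<Longrightarrow> wff (D @ [snd v]) p"
proof (induction p arbitrary: D)
  case (Forall r p)
  then show ?case using Forall.IH[of "r # D"] by simp
qed (auto intro: has_ty_inst_FVar)

lemma has_ty_close: "has_ty D t b \<Longrightarrow> has_ty (D @ [snd v]) (close_tm (length D) v t) b"
  by (induction t arbitrary: b) (auto simp: nth_append)

lemma wff_close: "wff D p \<Longrightarrow> wff (D @ [snd v]) (close (length D) v p)"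
proof (induction p arbitrary: D)
  case (Forall r p)
  then show ?case using Forall.IH[of "r # D"] by simp
qed (auto intro: has_ty_close)

lemma wff_all_var: "wff [] p \<Longrightarrow> wff [] (\<^bold>\<forall>v. p)"
  using wff_close[of "[]"] by (simp add: all_var_def)

lemma wff_ex_var: "wff [] p \<Longrightarrow> wff [] (\<^bold>\<exists>v. p)"
  by (simp add: ex_var_def wff_all_var)

lemma wff_subst: "wff [] p \<Longrightarrow> has_ty [] t (snd v) \<Longrightarrow> wff [] (subst p v t)"
  using wff_close[of "[]" p v] by (auto simp: subst_def intro: wff_inst0)

lemma inst_tm_closed: "has_ty D t a \<Longrightarrow> length D \<le> k \<Longrightarrow> inst_tm k u t = t"
  by (induction t arbitrary: a) auto

lemma inst_close_tm:
  "has_ty D t a \<Longrightarrow> inst_tm (length D) (FVar v) (close_tm (length D) v t) = t"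
  by (induction t arbitrary: a) auto

lemma inst_close: "wff D p \<Longrightarrow> inst (length D) (FVar v) (close (length D) v p) = p"
proof (induction p arbitrary: D)
  case (Forall r p)
  then show ?case using Forall.IH[of "r # D"] by simp
qed (auto intro: inst_close_tm)

lemma close_inst_tm: "v \<notin> fv_tm t \<Longrightarrow> close_tm k v (inst_tm k (FVar v) t) = t"
  by (induction t) auto

lemma close_inst: "v \<notin> fv p \<Longrightarrow> close k v (inst k (FVar v) p) = p"
  by (induction p arbitrary: k) (auto simp: close_inst_tm)

lemma fv_close_tm [simp]: "fv_tm (close_tm k v t) = fv_tm t - {v}"
  by (induction t) auto

lemma fv_close [simp]: "fv (close k v p) = fv p - {v}"
  by (induction p arbitrary: k) auto

lemma finite_fv: "finite (fv p)"
proof -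
  have "finite (fv_tm t)" for t by (induction t) auto
  then show ?thesis by (induction p) auto
qed

lemma ex_fresh_var:
  fixes V :: "var set"
  assumes "finite V"
  shows "\<exists>v. snd v = r \<and> v \<notin> V"
proof -
  note assms
  moreover have "infinite (range (\<lambda>a::string. (a, r)))"
    by (simp add: finite_image_iff inj_on_def infinite_UNIV_listI)
  ultimately obtain v where "v \<in> range (\<lambda>a::string. (a, r))" "v \<notin> V"
    by (metis finite_subset subsetI)
  then show ?thesis by auto
qed

section \<open>Lifting and the formulas for extensional equality\<close>

lemma lift_closed: "has_ty [] t a \<Longrightarrow> lift t = t"
  by (induction t arbitrary: a) auto

lemma has_ty_lift: "has_ty D t a \<Longrightarrow> has_ty (r # D) (lift t) a"
  by (induction t arbitrary: a) auto

lemma wff_eq_at: "has_ty D s a \<Longrightarrow> has_ty D t a \<Longrightarrow> wff D (eq_at a s t)"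
proof (induction a arbitrary: D s t)
  case (Arr a b)
  then have "has_ty (a # D) (lift u \<cdot> BVar 0) b" if "u \<in> {s, t}" for u
    using that has_ty_lift[of D u "a \<rightarrow> b" a] by auto
  then show ?case using Arr.IH(2) by simp
qed auto

text \<open>A term without dangling indices is fixed by \<open>lift\<close>, so instantiation passes
  through the lifting that \<open>eq_at\<close> performs at every function type.\<close>

lemma inst_tm_lift:
  assumes "has_ty [] u a"
  shows "inst_tm (Suc k) u (lift t) = lift (inst_tm k u t)"
  using lift_closed[OF assms] by (induction t) auto

lemma inst_eq_at: "has_ty [] u a \<Longrightarrow> inst k u (eq_at b s t) = eq_at b (inst_tm k u s) (inst_tm k u t)"
  by (induction b arbitrary: k s t) (auto simp: inst_tm_lift)

lemma deriv_wff: "deriv T G p \<Longrightarrow> wff [] p"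
proof (induction rule: deriv.induct)
  case (ForallI G v p r)
  then show ?case using wff_inst_FVar[of "[]" v p] by simp
qed (auto intro: wff_inst0)

subsection \<open>Hilbert-style consequence\<close>

text \<open>This and the following provabilities are the axioms and the generalisation rule of a
  Hilbert calculus: K and S carry the deduction theorem for \<open>ded\<close>, the vacuous and
  distributed quantifier carry generalisation, double negation makes it classical.\<close>

lemma prov_K: "wff [] p \<Longrightarrow> wff [] q \<Longrightarrow> T \<turnstile> p \<^bold>\<longrightarrow> q \<^bold>\<longrightarrow> p"
  by (intro ImpI Assm) auto

lemma prov_S:
  assumes "wff [] p" "wff [] q" "wff [] r"
  shows "T \<turnstile> (p \<^bold>\<longrightarrow> q \<^bold>\<longrightarrow> r) \<^bold>\<longrightarrow> (p \<^bold>\<longrightarrow> q) \<^bold>\<longrightarrow> p \<^bold>\<longrightarrow> r"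
proof -
  let ?G = "[p, p \<^bold>\<longrightarrow> q, p \<^bold>\<longrightarrow> q \<^bold>\<longrightarrow> r]"
  have p: "deriv T ?G p" and "deriv T ?G (p \<^bold>\<longrightarrow> q)" "deriv T ?G (p \<^bold>\<longrightarrow> q \<^bold>\<longrightarrow> r)"
    using assms by (auto intro: Assm)
  then have "deriv T ?G r" using ImpE by blast
  then show ?thesis using assms by (intro ImpI) auto
qed

lemma prov_DN: "wff [] p \<Longrightarrow> T \<turnstile> \<^bold>\<not> \<^bold>\<not> p \<^bold>\<longrightarrow> p"
  by (rule ImpI[OF _ Classical[OF _ ImpE[of _ _ "\<^bold>\<not> p" Bot]]]) (auto intro: Assm)

lemma prov_instance: "wff [r] p \<Longrightarrow> has_ty [] t r \<Longrightarrow> T \<turnstile> Forall r p \<^bold>\<longrightarrow> inst 0 t p"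
  by (intro ImpI ForallE Assm) auto

lemma prov_gen: "T \<turnstile> p \<Longrightarrow> T \<turnstile> \<^bold>\<forall>v. p"
  unfolding all_var_def using inst_close[of "[]" p v] deriv_wff[of T "[]" p]
  by (intro ForallI[where v = v]) auto

lemma prov_vacuous: "wff [] p \<Longrightarrow> v \<notin> fv p \<Longrightarrow> T \<turnstile> p \<^bold>\<longrightarrow> (\<^bold>\<forall>v. p)"
  unfolding all_var_def using inst_close[of "[]" p v]
  by (intro ImpI ForallI[where v = v]) (auto intro: Assm)

lemma prov_dist:
  assumes "wff [] p" "wff [] q"
  shows "T \<turnstile> (\<^bold>\<forall>v. p \<^bold>\<longrightarrow> q) \<^bold>\<longrightarrow> (\<^bold>\<forall>v. p) \<^bold>\<longrightarrow> (\<^bold>\<forall>v. q)"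
proof -
  let ?G = "[\<^bold>\<forall>v. p, \<^bold>\<forall>v. p \<^bold>\<longrightarrow> q]"
  have inst: "wff [] r \<Longrightarrow> inst 0 (FVar v) (close 0 v r) = r" for r
    using inst_close[of "[]" r v] by simp
  have elim: "deriv T ?G r" if "(\<^bold>\<forall>v. r) \<in> set ?G" "wff [] r" for r
  proof -
    have "deriv T ?G (Forall (snd v) (close 0 v r))"
      using that wff_all_var[of r v] by (intro Assm) (auto simp: all_var_def)
    from ForallE[OF this, of "FVar v"] show ?thesis
      using inst[OF that(2)] by simp
  qed
  have "deriv T ?G q"
    by (rule ImpE[of _ _ p]; rule elim) (use assms in auto)
  then have "deriv T ?G (\<^bold>\<forall>v. q)"
    unfolding all_var_def using inst[OF assms(2)]
    by (intro ForallI[where v = v]) (auto simp: all_var_def)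
  then show ?thesis
    using assms wff_all_var[of "p \<^bold>\<longrightarrow> q" v] wff_all_var[of p v] by (intro ImpI) auto
qed

text \<open>
  Assumptions are added to the empty-context calculus, not to the lists of \<open>deriv\<close>, for which
  weakening would require renaming eigenvariables in the axioms.
\<close>

inductive ded :: "fm set \<Rightarrow> fm set \<Rightarrow> fm \<Rightarrow> bool" for T S where
  prov: "T \<turnstile> p \<Longrightarrow> ded T S p"
| mem: "p \<in> S \<Longrightarrow> wff [] p \<Longrightarrow> ded T S p"
| mp: "ded T S (p \<^bold>\<longrightarrow> q) \<Longrightarrow> ded T S p \<Longrightarrow> ded T S q"

lemma ded_wff: "ded T S p \<Longrightarrow> wff [] p"
  by (induction rule: ded.induct) (auto dest: deriv_wff)

lemma ded_mono: "ded T S p \<Longrightarrow> S \<subseteq> S' \<Longrightarrow> ded T S' p"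
  by (induction rule: ded.induct) (auto intro: ded.intros)

lemma ded_empty: "ded T {} p \<Longrightarrow> T \<turnstile> p"
  by (induction rule: ded.induct) (auto intro: ImpE)

lemma ded_deduct:
  assumes "ded T (insert q S) p" "wff [] q"
  shows "ded T S (q \<^bold>\<longrightarrow> p)"
  using assms(1)
proof (induction rule: ded.induct)
  case (prov p)
  then show ?case using assms(2) by (meson ded.mp ded.prov deriv_wff prov_K)
next
  case (mem p)
  show ?case
  proof (cases "p = q")
    case True
    have "T \<turnstile> q \<^bold>\<longrightarrow> q" by (intro ImpI Assm) (use assms(2) in auto)
    then show ?thesis using True by (simp add: ded.prov)
  next
    case False
    then have "ded T S p" using mem by (auto intro: ded.mem)
    then show ?thesis using assms(2) mem by (meson ded.mp ded.prov prov_K)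
  qed
next
  case (mp p r)
  then have "wff [] p" "wff [] r" using ded_wff by fastforce+
  then show ?case using mp.IH assms(2) by (meson ded.mp ded.prov prov_S)
qed

lemma ded_compact: "ded T S p \<Longrightarrow> \<exists>S0\<subseteq>S. finite S0 \<and> ded T S0 p"
proof (induction rule: ded.induct)
  case (prov p)
  then show ?case by (intro exI[of _ "{}"]) (auto intro: ded.prov)
next
  case (mem p)
  then show ?case by (intro exI[of _ "{p}"]) (auto intro: ded.mem)
next
  case (mp p q)
  then obtain A B where "A \<subseteq> S" "finite A" "ded T A (p \<^bold>\<longrightarrow> q)" "B \<subseteq> S" "finite B" "ded T B p"
    by blast
  then show ?case
    by (intro exI[of _ "A \<union> B"]) (auto intro: ded.mp[of _ _ p] ded_mono)
qed

text \<open>Generalisation is not a rule of \<open>ded\<close> but is admissible: theorems are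
  generalised outright, hypotheses do not contain \<open>v\<close> and so imply their own
  generalisation, and modus ponens is pushed under the quantifier by
  \<open>prov_dist\<close>.\<close>

lemma ded_gen:
  assumes "ded T S p" "\<forall>q\<in>S. v \<notin> fv q"
  shows "ded T S (\<^bold>\<forall>v. p)"
  using assms(1)
proof (induction rule: ded.induct)
  case (prov p)
  then show ?case by (intro ded.prov prov_gen)
next
  case (mem p)
  then have "T \<turnstile> p \<^bold>\<longrightarrow> (\<^bold>\<forall>v. p)" using assms(2) by (intro prov_vacuous) auto
  then show ?case using mem by (meson ded.intros)
next
  case (mp p q)
  then have "wff [] p" "wff [] q" using ded_wff by fastforce+
  then show ?case using mp.IH by (meson ded.mp ded.prov prov_dist)
qed

lemma ded_DN: "ded T S (\<^bold>\<not> \<^bold>\<not> p) \<Longrightarrow> ded T S p"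
  using ded_wff[of T S "\<^bold>\<not> \<^bold>\<not> p"] by (auto intro: ded.mp[OF ded.prov[OF prov_DN]])

section \<open>Maximal consistent sets with witnesses\<close>

abbreviation consistent :: "fm set \<Rightarrow> fm set \<Rightarrow> bool" where
  "consistent T S \<equiv> \<not> ded T S Bot"

text \<open>If adding the witness were inconsistent, \<open>S\<close> would prove the instance at a
  variable fresh for \<open>S\<close>, hence its generalisation, against the negated universal
  formula already in \<open>S\<close>.\<close>

lemma consistent_insert_witness:
  assumes con: "consistent T S" and mem: "(\<^bold>\<not> Forall r q) \<in> S" and wf: "wff [r] q"
    and v: "snd v = r" "\<forall>p\<in>S. v \<notin> fv p"
  shows "consistent T (insert (\<^bold>\<not> inst 0 (FVar v) q) S)"
proof
  assume "ded T (insert (\<^bold>\<not> inst 0 (FVar v) q) S) Bot"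
  then have "ded T S (\<^bold>\<not> \<^bold>\<not> inst 0 (FVar v) q)"
    using wf v(1) by (intro ded_deduct) (auto intro: wff_inst0)
  then have "ded T S (\<^bold>\<forall>v. inst 0 (FVar v) q)" by (rule ded_gen[OF ded_DN v(2)])
  moreover have "v \<notin> fv q" using mem v(2) by force
  ultimately have "ded T S (Forall r q)" by (simp add: all_var_def close_inst v(1))
  moreover have "ded T S (\<^bold>\<not> Forall r q)" using mem wf by (intro ded.mem) auto
  ultimately show False using con ded.mp by blast
qed

text \<open>Maximisation and the choice of witnesses run together along an enumeration of all
  formulas. The stages stay finite, so ordinary variables can serve as Henkin constants and the
  language need not be extended.\<close>

lemma lindenbaum:
  assumes "wff [] p0" "\<not> T \<turnstile> p0"
  obtains H where "(\<^bold>\<not> p0) \<in> H" "consistent T H"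
    "\<And>p. wff [] p \<Longrightarrow> consistent T (insert p H) \<Longrightarrow> p \<in> H"
    "\<And>r q. (\<^bold>\<not> Forall r q) \<in> H \<Longrightarrow> wff [r] q \<Longrightarrow> \<exists>v. snd v = r \<and> (\<^bold>\<not> inst 0 (FVar v) q) \<in> H"
proof -
  let ?P = "\<lambda>(_::nat) S. finite S \<and> consistent T S \<and> (\<^bold>\<not> p0) \<in> S"
  let ?Q = "\<lambda>n S S'. S \<subseteq> S' \<and>
    (\<forall>p. p = from_nat n \<longrightarrow> wff [] p \<longrightarrow> consistent T (insert p S) \<longrightarrow> p \<in> S' \<and>
       (\<forall>r q. p = (\<^bold>\<not> Forall r q) \<longrightarrow> (\<exists>v. snd v = r \<and> (\<^bold>\<not> inst 0 (FVar v) q) \<in> S')))"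
  have "\<exists>f. \<forall>n. ?P n (f n) \<and> ?Q n (f n) (f (Suc n))"
  proof (rule dependent_nat_choice)
    have "consistent T {\<^bold>\<not> p0}"
      using assms ded_deduct[of T "\<^bold>\<not> p0" "{}" Bot] ded_DN ded_empty by auto
    then show "\<exists>S. ?P 0 S" by blast
  next
    fix S n
    assume P: "?P n S"
    define p :: fm where "p = from_nat n"
    show "\<exists>S'. ?P (Suc n) S' \<and> ?Q n S S'"
    proof (cases "wff [] p \<and> consistent T (insert p S)")
      case False
      then show ?thesis using P p_def by (intro exI[of _ S]) auto
    next
      case True
      show ?thesis
      proof (cases "\<exists>r q. p = (\<^bold>\<not> Forall r q)")
        case False
        then show ?thesis using P True p_def by (intro exI[of _ "insert p S"]) auto
      next
        case ex: True
        then obtain r q where p: "p = (\<^bold>\<not> Forall r q)" by blast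
        \<comment> \<open>Freshness is required for the new formula as well as for the stage, since
          both become hypotheses in the generalisation over \<open>v\<close>.\<close>
        have "finite (\<Union> (fv ` insert p S))" using P finite_fv by auto
        then obtain v where v: "snd v = r" "v \<notin> \<Union> (fv ` insert p S)"
          using ex_fresh_var by blast
        let ?S = "insert (\<^bold>\<not> inst 0 (FVar v) q) (insert p S)"
        have "consistent T ?S"
          using True p v by (intro consistent_insert_witness[where r = r]) auto
        then have 1: "?P (Suc n) ?S" using P by simp
        have 2: "?Q n S ?S"
        proof (intro conjI allI impI)
          show "S \<subseteq> ?S" by blast
          fix p' :: fm assume "p' = from_nat n"
          then have p': "p' = p" by (simp add: p_def)
          show "p' \<in> ?S" by (simp add: p')
          fix r' q' assume "p' = (\<^bold>\<not> Forall r' q')"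
          then have "r' = r" "q' = q" using p p' by auto
          then show "\<exists>w. snd w = r' \<and> (\<^bold>\<not> inst 0 (FVar w) q') \<in> ?S"
            by (intro exI[of _ v]) (simp add: v(1))
        qed
        from conjI[OF 1 2] show ?thesis by (rule exI)
      qed
    qed
  qed
  then obtain f where PQ: "\<forall>n. ?P n (f n) \<and> ?Q n (f n) (f (Suc n))" by (rule exE)
  note f = conjunct1[OF spec[OF PQ]] conjunct2[OF spec[OF PQ]]
  have sub: "f n \<subseteq> f (Suc n)" for n by (rule conjunct1[OF f(2)])
  define H where "H = (\<Union>n. f n)"
  have mono: "m \<le> n \<Longrightarrow> f m \<subseteq> f n" for m n
    by (rule lift_Suc_mono_le[where f = f, OF sub])
  have con: "consistent T H"
  proof
    assume "ded T H Bot"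
    then obtain S0 where S0: "S0 \<subseteq> H" "finite S0" "ded T S0 Bot"
      using ded_compact[of T H Bot] by blast
    have "\<exists>n. S0 \<subseteq> f n" using S0(2,1)
    proof (induction rule: finite_induct)
      case (insert x F)
      then obtain n m where "F \<subseteq> f n" "x \<in> f m" unfolding H_def by blast
      then have "insert x F \<subseteq> f (max n m)"
        using subsetD[OF mono[of m "max n m"]] subset_trans[OF _ mono[of n "max n m"]] by simp
      then show ?case by (rule exI)
    qed simp
    then obtain n where "S0 \<subseteq> f n" by (rule exE)
    with S0(3) have "ded T (f n) Bot" by (rule ded_mono)
    then show False using f(1)[of n] by simp
  qed
  have step: "p \<in> f (Suc (to_nat p)) \<and>
      (\<forall>r q. p = (\<^bold>\<not> Forall r q) \<longrightarrow> (\<exists>v. snd v = r \<and> (\<^bold>\<not> inst 0 (FVar v) q) \<in> f (Suc (to_nat p))))"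
    if "wff [] p" "consistent T (insert p H)" for p
  proof -
    have "consistent T (insert p (f (to_nat p)))"
      using that(2) ded_mono[of T "insert p (f (to_nat p))" Bot "insert p H"] by (auto simp: H_def)
    then show ?thesis using conjunct2[OF f(2)[of "to_nat p"]] that(1) by simp
  qed
  show ?thesis
  proof (rule that[of H])
    show "(\<^bold>\<not> p0) \<in> H" unfolding H_def using f(1)[of 0] by blast
    \<comment> \<open>A negated universal formula already in \<open>H\<close> is consistent with
      \<open>H\<close>, so it was accepted, together with its witness, at the stage that carries its
      own number.\<close>
    show "\<exists>v. snd v = r \<and> (\<^bold>\<not> inst 0 (FVar v) q) \<in> H" if "(\<^bold>\<not> Forall r q) \<in> H" "wff [r] q" for r q
      using step[of "\<^bold>\<not> Forall r q"] that con by (auto simp: H_def insert_absorb)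
  qed (use con step in \<open>auto simp: H_def\<close>)
qed

section \<open>Completeness\<close>

subsection \<open>Extensional models\<close>

text \<open>No laws are imposed yet: \<open>qf_pred\<close> has to exist before \<open>model\<close>
  can state its induction law. All types share one carrier, separated only by \<open>Dom\<close>,
  and \<open>cn\<close> is consulted at constants only.\<close>

locale applicative =
  fixes Dom :: "ty \<Rightarrow> 'd set" and ap :: "'d \<Rightarrow> 'd \<Rightarrow> 'd" (infixl "\<bullet>" 90) and cn :: "tm \<Rightarrow> 'd"
begin

primrec tval :: "(var \<Rightarrow> 'd) \<Rightarrow> 'd list \<Rightarrow> tm \<Rightarrow> 'd" where
  "tval e D (FVar v) = e v"
| "tval e D (BVar i) = D ! i"
| "tval e D Zero = cn Zero"
| "tval e D Sc = cn Sc"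
| "tval e D (CK a b) = cn (CK a b)"
| "tval e D (CS a b c) = cn (CS a b c)"
| "tval e D R0 = cn R0"
| "tval e D (s \<cdot> t) = tval e D s \<bullet> tval e D t"

primrec sat :: "(var \<Rightarrow> 'd) \<Rightarrow> 'd list \<Rightarrow> fm \<Rightarrow> bool" where
  "sat e D Bot \<longleftrightarrow> False"
| "sat e D (s \<^bold>= t) \<longleftrightarrow> tval e D s = tval e D t"
| "sat e D (p \<^bold>\<longrightarrow> q) \<longleftrightarrow> (sat e D p \<longrightarrow> sat e D q)"
| "sat e D (Forall r p) \<longleftrightarrow> (\<forall>x\<in>Dom r. sat e (x # D) p)"

text \<open>The semantic counterpart of quantifier-free formulas in one number variable. Parameters
  of arbitrary type are hidden in \<open>F\<close> and \<open>G\<close>, as combinatory completeness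
  turns each side of an equation into a type-1 element applied to the variable.\<close>

inductive qf_pred :: "('d \<Rightarrow> bool) \<Rightarrow> bool" where
  qf_Eq: "F \<in> Dom Tp1 \<Longrightarrow> G \<in> Dom Tp1 \<Longrightarrow> qf_pred (\<lambda>x. F \<bullet> x = G \<bullet> x)"
| qf_Bot: "qf_pred (\<lambda>x. False)"
| qf_Imp: "qf_pred P \<Longrightarrow> qf_pred Q \<Longrightarrow> qf_pred (\<lambda>x. P x \<longrightarrow> Q x)"

lemma tval_closed: "has_ty [] t a \<Longrightarrow> tval e D t = tval e [] t"
  by (induction t arbitrary: a) auto

lemma tval_inst:
  "has_ty (E @ [a]) t b \<Longrightarrow> has_ty [] u a \<Longrightarrow> length D = length E \<Longrightarrow>
    tval e D (inst_tm (length E) u t) = tval e (D @ [tval e [] u]) t"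
  using tval_closed[of u a e D]
  by (induction t arbitrary: b) (auto simp: nth_append)

lemma sat_inst:
  "wff (E @ [a]) p \<Longrightarrow> has_ty [] u a \<Longrightarrow> length D = length E \<Longrightarrow>
    sat e D (inst (length E) u p) \<longleftrightarrow> sat e (D @ [tval e [] u]) p"
proof (induction p arbitrary: D E)
  case (Forall r p)
  have "sat e (x # D) (inst (length (r # E)) u p) \<longleftrightarrow> sat e ((x # D) @ [tval e [] u]) p" for x
    using Forall.prems by (intro Forall.IH) auto
  then show ?case by simp
next
  case (Eq s t)
  then show ?case using tval_inst[of E a _ Tp0 u D e] by simp
qed auto

lemma tval_close:
  "has_ty E t b \<Longrightarrow> length D = length E \<Longrightarrow>
    tval e (D @ [x]) (close_tm (length E) v t) = tval (e(v := x)) D t"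
  by (induction t arbitrary: b) (auto simp: nth_append)

lemma sat_close:
  "wff E p \<Longrightarrow> length D = length E \<Longrightarrow>
    sat e (D @ [x]) (close (length E) v p) \<longleftrightarrow> sat (e(v := x)) D p"
proof (induction p arbitrary: D E)
  case (Forall r p)
  have "sat e ((y # D) @ [x]) (close (length (r # E)) v p) \<longleftrightarrow> sat (e(v := x)) (y # D) p" for y
    using Forall.prems by (intro Forall.IH) auto
  then show ?case by (simp add: fun_upd_def)
next
  case (Eq s t)
  then show ?case using tval_close[of E _ Tp0 D e x v] by (simp add: fun_upd_def)
qed auto

lemma sat_all_var:
  "wff [] p \<Longrightarrow> sat e [] (\<^bold>\<forall>v. p) \<longleftrightarrow> (\<forall>x\<in>Dom (snd v). sat (e(v := x)) [] p)"
  using sat_close[of "[]" p "[]" e _ v] by (simp add: all_var_def)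

lemma sat_ex_var:
  "wff [] p \<Longrightarrow> sat e [] (\<^bold>\<exists>v. p) \<longleftrightarrow> (\<exists>x\<in>Dom (snd v). sat (e(v := x)) [] p)"
  by (simp add: ex_var_def sat_all_var)

lemma sat_subst:
  assumes "wff [] p" "has_ty [] t (snd v)"
  shows "sat e [] (subst p v t) \<longleftrightarrow> sat (e(v := tval e [] t)) [] p"
  using sat_inst[of "[]" "snd v" "close 0 v p" t "[]" e] sat_close[of "[]" p "[]" e _ v]
    wff_close[of "[]" p v] assms by (simp add: subst_def)

end

locale model = applicative Dom ap cn
  for Dom :: "ty \<Rightarrow> 'd set" and ap :: "'d \<Rightarrow> 'd \<Rightarrow> 'd" (infixl "\<bullet>" 90) and cn :: "tm \<Rightarrow> 'd" +
  assumes ap_Dom: "F \<in> Dom (a \<rightarrow> b) \<Longrightarrow> x \<in> Dom a \<Longrightarrow> F \<bullet> x \<in> Dom b"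
    and ext: "F \<in> Dom (a \<rightarrow> b) \<Longrightarrow> G \<in> Dom (a \<rightarrow> b) \<Longrightarrow>
      (\<And>x. x \<in> Dom a \<Longrightarrow> F \<bullet> x = G \<bullet> x) \<Longrightarrow> F = G"
    and Zero_Dom: "cn Zero \<in> Dom Tp0"
    and Sc_Dom: "cn Sc \<in> Dom Tp1"
    and CK_Dom: "cn (CK a b) \<in> Dom (a \<rightarrow> b \<rightarrow> a)"
    and CS_Dom: "cn (CS a b c) \<in> Dom ((a \<rightarrow> b \<rightarrow> c) \<rightarrow> (a \<rightarrow> b) \<rightarrow> a \<rightarrow> c)"
    and R0_Dom: "cn R0 \<in> Dom (Tp0 \<rightarrow> Tp0 \<rightarrow> (Tp0 \<rightarrow> Tp0 \<rightarrow> Tp0) \<rightarrow> Tp0)"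
    and CK_ap: "x \<in> Dom a \<Longrightarrow> y \<in> Dom b \<Longrightarrow> cn (CK a b) \<bullet> x \<bullet> y = x"
    and CS_ap: "x \<in> Dom (a \<rightarrow> b \<rightarrow> c) \<Longrightarrow> y \<in> Dom (a \<rightarrow> b) \<Longrightarrow> z \<in> Dom a \<Longrightarrow>
      cn (CS a b c) \<bullet> x \<bullet> y \<bullet> z = x \<bullet> z \<bullet> (y \<bullet> z)"
    and R0_Zero_ap: "x \<in> Dom Tp0 \<Longrightarrow> z \<in> Dom (Tp0 \<rightarrow> Tp0 \<rightarrow> Tp0) \<Longrightarrow> cn R0 \<bullet> cn Zero \<bullet> x \<bullet> z = x"
    and R0_Sc_ap: "n \<in> Dom Tp0 \<Longrightarrow> x \<in> Dom Tp0 \<Longrightarrow> z \<in> Dom (Tp0 \<rightarrow> Tp0 \<rightarrow> Tp0) \<Longrightarrow>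
      cn R0 \<bullet> (cn Sc \<bullet> n) \<bullet> x \<bullet> z = z \<bullet> (cn R0 \<bullet> n \<bullet> x \<bullet> z) \<bullet> n"
    and Sc_neq_Zero: "x \<in> Dom Tp0 \<Longrightarrow> cn Sc \<bullet> x \<noteq> cn Zero"
    and Sc_inj: "x \<in> Dom Tp0 \<Longrightarrow> y \<in> Dom Tp0 \<Longrightarrow> cn Sc \<bullet> x = cn Sc \<bullet> y \<Longrightarrow> x = y"
    and induct: "qf_pred P \<Longrightarrow> P (cn Zero) \<Longrightarrow>
      (\<And>x. x \<in> Dom Tp0 \<Longrightarrow> P x \<Longrightarrow> P (cn Sc \<bullet> x)) \<Longrightarrow> x \<in> Dom Tp0 \<Longrightarrow> P x"

subsection \<open>The term model of a maximal consistent set\<close>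

locale henkin =
  fixes T H :: "fm set"
  assumes EPRA: "EPRA \<subseteq> T" and con: "consistent T H"
    and maximal: "\<And>p. wff [] p \<Longrightarrow> consistent T (insert p H) \<Longrightarrow> p \<in> H"
    and witness: "\<And>r q. (\<^bold>\<not> Forall r q) \<in> H \<Longrightarrow> wff [r] q \<Longrightarrow>
      \<exists>v. snd v = r \<and> (\<^bold>\<not> inst 0 (FVar v) q) \<in> H"
begin

lemma mem_iff: "wff [] p \<Longrightarrow> p \<in> H \<longleftrightarrow> ded T H p"
proof
  assume "wff [] p" "ded T H p"
  then have "consistent T (insert p H)" using con ded_deduct ded.mp by blast
  then show "p \<in> H" using \<open>wff [] p\<close> maximal by blast
qed (auto intro: ded.mem)

lemma neg_mem: "wff [] p \<Longrightarrow> (\<^bold>\<not> p) \<in> H \<longleftrightarrow> p \<notin> H"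
proof
  assume p: "wff [] p" and "p \<notin> H"
  then have "ded T (insert p H) Bot" using maximal by blast
  then have "ded T H (\<^bold>\<not> p)" using p by (rule ded_deduct)
  then show "(\<^bold>\<not> p) \<in> H" using p mem_iff by simp
next
  assume "wff [] p" "(\<^bold>\<not> p) \<in> H"
  then show "p \<notin> H" using con mem_iff[of "\<^bold>\<not> p"] mem_iff[of p] ded.mp by auto
qed

lemma Bot_mem: "Bot \<notin> H"
  using con mem_iff[of Bot] by simp

lemma Imp_mem:
  assumes "wff [] p" "wff [] q"
  shows "(p \<^bold>\<longrightarrow> q) \<in> H \<longleftrightarrow> (p \<in> H \<longrightarrow> q \<in> H)"
proof
  assume "(p \<^bold>\<longrightarrow> q) \<in> H"
  then show "p \<in> H \<longrightarrow> q \<in> H"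
    using assms mem_iff[of "p \<^bold>\<longrightarrow> q"] mem_iff[of p] mem_iff[of q] ded.mp by auto
next
  assume pq: "p \<in> H \<longrightarrow> q \<in> H"
  have "ded T (insert p H) q"
  proof (cases "p \<in> H")
    case True
    then have "ded T H q" using pq assms mem_iff by blast
    then show ?thesis by (rule ded_mono) auto
  next
    case False
    then have "ded T (insert p H) Bot" using maximal assms by blast
    \<comment> \<open>Ex falso: this instance of K reads as \<open>Bot\<close> implying the double
      negation of \<open>q\<close>.\<close>
    moreover have "T \<turnstile> Bot \<^bold>\<longrightarrow> \<^bold>\<not> q \<^bold>\<longrightarrow> Bot" using prov_K[of Bot "\<^bold>\<not> q" T] assms by simp
    ultimately show ?thesis using ded.mp ded.prov ded_DN by blast
  qed
  then show "(p \<^bold>\<longrightarrow> q) \<in> H" using ded_deduct mem_iff[of "p \<^bold>\<longrightarrow> q"] assms by simp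
qed

text \<open>Witnesses make the universal quantifier range exactly over the well typed terms without
  dangling indices, which is why these terms can form a model.\<close>

lemma Forall_mem:
  assumes "wff [r] q"
  shows "Forall r q \<in> H \<longleftrightarrow> (\<forall>t. has_ty [] t r \<longrightarrow> inst 0 t q \<in> H)"
proof (intro iffI allI impI)
  fix t assume "Forall r q \<in> H" "has_ty [] t r"
  then show "inst 0 t q \<in> H"
    using assms prov_instance[of r q t T] wff_inst0[of r q t] mem_iff[of "Forall r q"]
      mem_iff[of "inst 0 t q"] ded.mp ded.prov by (metis wff.simps(4))
next
  assume *: "\<forall>t. has_ty [] t r \<longrightarrow> inst 0 t q \<in> H"
  show "Forall r q \<in> H"
  proof (rule ccontr)
    assume "Forall r q \<notin> H"
    then have "(\<^bold>\<not> Forall r q) \<in> H" using assms neg_mem[of "Forall r q"] by simp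
    then obtain v where v: "snd v = r" "(\<^bold>\<not> inst 0 (FVar v) q) \<in> H" using witness assms by blast
    then have "wff [] (inst 0 (FVar v) q)" using assms by (auto intro: wff_inst0)
    then show False using v * neg_mem by simp
  qed
qed

lemma axiom_mem: "p \<in> EPRA \<Longrightarrow> wff [] p \<Longrightarrow> p \<in> H"
  using EPRA mem_iff ded.prov Axiom by blast

definition eqv :: "ty \<Rightarrow> tm \<Rightarrow> tm \<Rightarrow> bool" where
  "eqv a s t \<longleftrightarrow> has_ty [] s a \<and> has_ty [] t a \<and> eq_at a s t \<in> H"

text \<open>As \<open>eq_at\<close> unfolds to a universal formula, membership in \<open>H\<close>
  makes provable equality at an arrow type pointwise over terms. Equivalence laws at higher types
  then follow by induction on the type.\<close>

lemma eqv_Arr: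
  "eqv (a \<rightarrow> b) s t \<longleftrightarrow> has_ty [] s (a \<rightarrow> b) \<and> has_ty [] t (a \<rightarrow> b) \<and>
     (\<forall>u. has_ty [] u a \<longrightarrow> eqv b (s \<cdot> u) (t \<cdot> u))"
proof (cases "has_ty [] s (a \<rightarrow> b) \<and> has_ty [] t (a \<rightarrow> b)")
  case True
  let ?q = "eq_at b (lift s \<cdot> BVar 0) (lift t \<cdot> BVar 0)"
  have "wff [a] ?q" using True wff_eq_at[of "[]" s "a \<rightarrow> b" t] by simp
  moreover have "inst 0 u ?q = eq_at b (s \<cdot> u) (t \<cdot> u)" if "has_ty [] u a" for u
    using True that by (simp add: inst_eq_at lift_closed[where a = "a \<rightarrow> b"] inst_tm_closed[where D = "[]" and a = "a \<rightarrow> b"])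
  ultimately have "eq_at (a \<rightarrow> b) s t \<in> H \<longleftrightarrow>
      (\<forall>u. has_ty [] u a \<longrightarrow> eq_at b (s \<cdot> u) (t \<cdot> u) \<in> H)"
    using Forall_mem[of a ?q] by simp
  then show ?thesis using True by (auto simp: eqv_def)
qed (auto simp: eqv_def)

lemma eqv_refl: "has_ty [] s a \<Longrightarrow> eqv a s s"
proof (induction a arbitrary: s)
  case Tp0
  then show ?case by (auto simp: eqv_def intro: axiom_mem EPRA.eq_refl)
next
  case (Arr a b)
  have "eqv b (s \<cdot> u) (s \<cdot> u)" if "has_ty [] u a" for u
    using that Arr.prems by (intro Arr.IH(2)) auto
  then show ?case using Arr.prems by (simp add: eqv_Arr)
qed

lemma eqv_sym: "eqv a s t \<Longrightarrow> eqv a t s"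
proof (induction a arbitrary: s t)
  case Tp0
  then have "(s \<^bold>= t \<^bold>\<longrightarrow> t \<^bold>= s) \<in> H" by (auto simp: eqv_def intro!: axiom_mem EPRA.eq_sym)
  then show ?case using Tp0 by (auto simp: eqv_def Imp_mem)
qed (auto simp: eqv_Arr)

lemma eqv_trans: "eqv a s t \<Longrightarrow> eqv a t u \<Longrightarrow> eqv a s u"
proof (induction a arbitrary: s t u)
  case Tp0
  then have "(s \<^bold>= t \<^bold>\<longrightarrow> t \<^bold>= u \<^bold>\<longrightarrow> s \<^bold>= u) \<in> H"
    by (auto simp: eqv_def intro!: axiom_mem EPRA.eq_trans)
  then show ?case using Tp0 by (auto simp: eqv_def Imp_mem)
next
  case (Arr a b)
  then show ?case unfolding eqv_Arr by blast
qed

text \<open>The extensionality axiom exchanges the argument and pointwise equality exchanges the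
  function. This is where full extensionality makes application well defined on classes.\<close>

lemma eqv_App:
  assumes "eqv (a \<rightarrow> b) s s'" "eqv a t t'"
  shows "eqv b (s \<cdot> t) (s' \<cdot> t')"
proof -
  have ty: "has_ty [] s (a \<rightarrow> b)" "has_ty [] s' (a \<rightarrow> b)" "has_ty [] t a" "has_ty [] t' a"
    using assms by (auto simp: eqv_def)
  then have wf: "has_ty [] (s \<cdot> t) b" "has_ty [] (s \<cdot> t') b" by auto
  then have "(eq_at a t t' \<^bold>\<longrightarrow> eq_at b (s \<cdot> t) (s \<cdot> t')) \<in> H"
    using ty wf by (intro axiom_mem EPRA.extensionality) (simp_all only: wff.simps wff_eq_at simp_thms)
  then have "eqv b (s \<cdot> t) (s \<cdot> t')"
    using assms(2) wf ty by (auto simp: eqv_def Imp_mem wff_eq_at)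
  moreover have "eqv b (s \<cdot> t') (s' \<cdot> t')"
    using assms(1) ty unfolding eqv_Arr by blast
  ultimately show ?thesis by (rule eqv_trans)
qed

definition cls :: "tm \<Rightarrow> tm set" where
  "cls s = {t. \<exists>a. eqv a s t}"

definition term_Dom :: "ty \<Rightarrow> tm set set" where
  "term_Dom a = cls ` {t. has_ty [] t a}"

text \<open>Arbitrary representatives are picked; \<open>ap_cls\<close> shows that on well typed
  classes the choice does not affect the result.\<close>

definition term_ap :: "tm set \<Rightarrow> tm set \<Rightarrow> tm set" where
  "term_ap A B = cls ((SOME s. s \<in> A) \<cdot> (SOME t. t \<in> B))"

lemma mem_cls: "has_ty [] s a \<Longrightarrow> t \<in> cls s \<longleftrightarrow> eqv a s t"
  using has_ty_unique by (auto simp: cls_def eqv_def)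

lemma cls_eq: "has_ty [] s a \<Longrightarrow> has_ty [] t a \<Longrightarrow> cls s = cls t \<longleftrightarrow> eqv a s t"
proof
  assume s: "has_ty [] s a" and t: "has_ty [] t a"
  {
    assume "cls s = cls t"
    then show "eqv a s t" using mem_cls[OF s] mem_cls[OF t] eqv_refl[OF t] by blast
  next
    assume "eqv a s t"
    then show "cls s = cls t"
      using mem_cls[OF s] mem_cls[OF t] eqv_sym eqv_trans by blast
  }
qed

lemma cls_Dom: "has_ty [] t a \<Longrightarrow> cls t \<in> term_Dom a"
  by (auto simp: term_Dom_def)

lemma ap_cls:
  assumes s: "has_ty [] s (a \<rightarrow> b)" and t: "has_ty [] t a"
  shows "term_ap (cls s) (cls t) = cls (s \<cdot> t)"
proof -
  define s' where "s' = (SOME u. u \<in> cls s)"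
  define t' where "t' = (SOME u. u \<in> cls t)"
  have "s' \<in> cls s" unfolding s'_def using mem_cls[OF s] eqv_refl[OF s] by (metis someI_ex)
  then have s': "eqv (a \<rightarrow> b) s s'" using mem_cls[OF s] by simp
  have "t' \<in> cls t" unfolding t'_def using mem_cls[OF t] eqv_refl[OF t] by (metis someI_ex)
  then have t': "eqv a t t'" using mem_cls[OF t] by simp
  have "eqv b (s \<cdot> t) (s' \<cdot> t')" using s' t' by (rule eqv_App)
  moreover from this have "has_ty [] (s \<cdot> t) b" "has_ty [] (s' \<cdot> t') b" by (simp_all only: eqv_def)
  ultimately have "cls (s \<cdot> t) = cls (s' \<cdot> t')" using cls_eq by blast
  then show ?thesis by (simp add: term_ap_def s'_def t'_def)
qed

sublocale M: applicative term_Dom term_ap cls .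

text \<open>A semantic quantifier-free predicate is turned back into a formula, with
  \<open>BVar 0\<close> as the hole and representing terms in place of its parameters, so that the
  induction axiom can be applied to it.\<close>

lemma qf_pred_repr:
  assumes "M.qf_pred P"
  shows "\<exists>p. qf p \<and> wff [Tp0] p \<and> (\<forall>t. has_ty [] t Tp0 \<longrightarrow> P (cls t) \<longleftrightarrow> inst 0 t p \<in> H)"
  using assms
proof (induction rule: M.qf_pred.induct)
  case (qf_Eq F G)
  then obtain f g where f: "F = cls f" "has_ty [] f Tp1" and g: "G = cls g" "has_ty [] g Tp1"
    by (auto simp: term_Dom_def)
  let ?p = "f \<cdot> BVar 0 \<^bold>= g \<cdot> BVar 0"
  have "term_ap F (cls t) = term_ap G (cls t) \<longleftrightarrow> inst 0 t ?p \<in> H" if t: "has_ty [] t Tp0" for t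
  proof -
    have ft: "has_ty [] (f \<cdot> t) Tp0" "has_ty [] (g \<cdot> t) Tp0" using f g t by auto
    have "term_ap F (cls t) = term_ap G (cls t) \<longleftrightarrow> cls (f \<cdot> t) = cls (g \<cdot> t)"
      using f g t by (simp add: ap_cls)
    also have "\<dots> \<longleftrightarrow> (f \<cdot> t \<^bold>= g \<cdot> t) \<in> H" using ft by (simp only: cls_eq eqv_def eq_at.simps simp_thms)
    finally show ?thesis
      using f(2) g(2) by (simp add: inst_tm_closed[where D = "[]" and a = Tp1])
  qed
  moreover have "wff [Tp0] ?p" using has_ty_append[of "[]" _ Tp1 "[Tp0]"] f g by auto
  ultimately show ?case by (intro exI[of _ ?p]) auto
next
  case qf_Bot
  then show ?case by (intro exI[of _ Bot]) (simp add: Bot_mem)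
next
  case (qf_Imp P Q)
  then obtain p q where "qf p" "wff [Tp0] p" "\<forall>t. has_ty [] t Tp0 \<longrightarrow> P (cls t) \<longleftrightarrow> inst 0 t p \<in> H"
    "qf q" "wff [Tp0] q" "\<forall>t. has_ty [] t Tp0 \<longrightarrow> Q (cls t) \<longleftrightarrow> inst 0 t q \<in> H" by blast
  then show ?case by (intro exI[of _ "p \<^bold>\<longrightarrow> q"]) (auto simp: Imp_mem wff_inst0)
qed

lemma qf_inst: "qf p \<Longrightarrow> qf (inst k u p)"
  by (induction p arbitrary: k) auto

lemma term_induct:
  assumes "M.qf_pred P" "P (cls Zero)"
    and step: "\<And>x. x \<in> term_Dom Tp0 \<Longrightarrow> P x \<Longrightarrow> P (term_ap (cls Sc) x)" and x: "x \<in> term_Dom Tp0"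
  shows "P x"
proof -
  obtain p where p: "qf p" "wff [Tp0] p" "\<And>t. has_ty [] t Tp0 \<Longrightarrow> P (cls t) \<longleftrightarrow> inst 0 t p \<in> H"
    using qf_pred_repr[OF assms(1)] by blast
  obtain n where n: "snd n = Tp0" "n \<notin> fv p" using ex_fresh_var[OF finite_fv] by blast
  define q where "q = inst 0 (FVar n) p"
  have q: "qf q" "wff [] q" unfolding q_def using p n by (auto intro: qf_inst wff_inst0)
  have close_q: "close 0 n q = p" using n(2) by (simp add: q_def close_inst)
  then have subst_q: "subst q n t = inst 0 t p" for t by (simp add: subst_def)
  let ?step = "q \<^bold>\<longrightarrow> subst q n (Sc \<cdot> FVar n)"
  have wf_sub: "wff [] (subst q n t)" if "has_ty [] t Tp0" for t
    using that q n by (intro wff_subst) auto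
  have wf_step: "wff [] ?step" using q wf_sub[of "Sc \<cdot> FVar n"] n by simp
  \<comment> \<open>Freshness of \<open>n\<close> collapses the nested substitutions: replacing the
    hole by the successor of \<open>n\<close> and then \<open>n\<close> by \<open>t\<close> amounts
    to replacing the hole by the successor of \<open>t\<close>.\<close>
  have inst_step: "inst 0 t (close 0 n ?step) = (inst 0 t p \<^bold>\<longrightarrow> inst 0 (Sc \<cdot> t) p)"
    if t: "has_ty [] t Tp0" for t
  proof -
    have "inst_tm k t (close_tm k n (inst_tm k (Sc \<cdot> FVar n) s)) = inst_tm k (Sc \<cdot> t) s"
      if "n \<notin> fv_tm s" for s k using that by (induction s) auto
    then have "inst k t (close k n (inst k (Sc \<cdot> FVar n) r)) = inst k (Sc \<cdot> t) r"
      if "n \<notin> fv r" for r k using that by (induction r arbitrary: k) auto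
    then show ?thesis using n(2) by (simp add: close_q subst_q)
  qed
  have "(subst q n Zero \<^bold>\<and> (\<^bold>\<forall>n. ?step) \<^bold>\<longrightarrow> (\<^bold>\<forall>n. q)) \<in> H"
    using q n wf_sub[of Zero] wff_all_var[OF wf_step, of n] wff_all_var[OF q(2), of n]
    by (intro axiom_mem EPRA.qf_induction[where a = "fst n"]) (auto simp: prod_eq_iff)
  moreover have "subst q n Zero \<in> H" using assms(2) p(3)[of Zero] by (simp add: subst_q)
  moreover have "(\<^bold>\<forall>n. ?step) \<in> H"
  proof -
    have "(inst 0 t p \<^bold>\<longrightarrow> inst 0 (Sc \<cdot> t) p) \<in> H" if t: "has_ty [] t Tp0" for t
    proof -
      have "P (cls t) \<Longrightarrow> P (term_ap (cls Sc) (cls t))" using step cls_Dom t by blast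
      moreover have "term_ap (cls Sc) (cls t) = cls (Sc \<cdot> t)" using t by (intro ap_cls[where a = Tp0]) auto
      ultimately show ?thesis
        using p(3)[OF t] p(3)[of "Sc \<cdot> t"] t p(2) by (simp add: Imp_mem wff_inst0)
    qed
    then show ?thesis
      using inst_step wf_step Forall_mem[of Tp0 "close 0 n ?step"] wff_close[of "[]" ?step n] n
      by (simp add: all_var_def del: close.simps)
  qed
  ultimately have "(\<^bold>\<forall>n. q) \<in> H"
    using wf_sub[of Zero] wff_all_var[OF wf_step, of n] wff_all_var[OF q(2), of n]
    by (simp add: Imp_mem Bot_mem)
  then have "inst 0 t p \<in> H" if "has_ty [] t Tp0" for t
    using that n(1) p(2) by (simp add: all_var_def close_q Forall_mem)
  then show ?thesis using x p(3) by (auto simp: term_Dom_def)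
qed

text \<open>Each law is the matching axiom, which lies in \<open>H\<close>, read through
  \<open>cls_eq\<close> and \<open>ap_cls\<close>. The types of all partial applications are listed
  because \<open>ap_cls\<close> must know the type of the function it applies.\<close>

sublocale M: model term_Dom term_ap cls
proof
  fix F G x a b
  {
    assume "F \<in> term_Dom (a \<rightarrow> b)" "x \<in> term_Dom a"
    then show "term_ap F x \<in> term_Dom b" by (auto simp: term_Dom_def ap_cls intro!: imageI exI)
  next
    assume F: "F \<in> term_Dom (a \<rightarrow> b)" and G: "G \<in> term_Dom (a \<rightarrow> b)"
      and eq: "\<And>x. x \<in> term_Dom a \<Longrightarrow> term_ap F x = term_ap G x"
    obtain f g where f: "F = cls f" "has_ty [] f (a \<rightarrow> b)" and g: "G = cls g" "has_ty [] g (a \<rightarrow> b)"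
      using F G by (auto simp: term_Dom_def)
    have "eqv b (f \<cdot> u) (g \<cdot> u)" if u: "has_ty [] u a" for u
    proof -
      have "has_ty [] (f \<cdot> u) b" "has_ty [] (g \<cdot> u) b" using f g u by auto
      then show ?thesis using eq[OF cls_Dom[OF u]] f g u by (simp add: ap_cls cls_eq del: has_ty.simps)
    qed
    then show "F = G" using f g by (simp add: cls_eq eqv_Arr)
  }
next
  fix x y z a b c
  {
    assume "x \<in> term_Dom a" "y \<in> term_Dom b"
    then obtain s t where s: "x = cls s" "has_ty [] s a" and t: "y = cls t" "has_ty [] t b"
      by (auto simp: term_Dom_def)
    have ty: "has_ty [] (CK a b \<cdot> s) (b \<rightarrow> a)" "has_ty [] (CK a b \<cdot> s \<cdot> t) a" using s t by auto
    have "eq_at a (CK a b \<cdot> s \<cdot> t) s \<in> H"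
      using s t ty by (intro axiom_mem EPRA.CK wff_eq_at)
    then have "cls (CK a b \<cdot> s \<cdot> t) = cls s" using cls_eq ty s by (simp only: eqv_def simp_thms)
    moreover have "term_ap (cls (CK a b)) (cls s) = cls (CK a b \<cdot> s)"
      using s by (intro ap_cls) auto
    moreover have "term_ap (cls (CK a b \<cdot> s)) (cls t) = cls (CK a b \<cdot> s \<cdot> t)"
      using ty t by (intro ap_cls)
    ultimately show "term_ap (term_ap (cls (CK a b)) x) y = x" using s t by simp
  next
    assume "x \<in> term_Dom (a \<rightarrow> b \<rightarrow> c)" "y \<in> term_Dom (a \<rightarrow> b)" "z \<in> term_Dom a"
    then obtain s t u where s: "x = cls s" "has_ty [] s (a \<rightarrow> b \<rightarrow> c)"
      and t: "y = cls t" "has_ty [] t (a \<rightarrow> b)" and u: "z = cls u" "has_ty [] u a"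
      by (auto simp: term_Dom_def)
    let ?S = "CS a b c"
    have ty: "has_ty [] (?S \<cdot> s) ((a \<rightarrow> b) \<rightarrow> a \<rightarrow> c)" "has_ty [] (?S \<cdot> s \<cdot> t) (a \<rightarrow> c)"
      "has_ty [] (?S \<cdot> s \<cdot> t \<cdot> u) c" "has_ty [] (s \<cdot> u) (b \<rightarrow> c)" "has_ty [] (t \<cdot> u) b"
      "has_ty [] (s \<cdot> u \<cdot> (t \<cdot> u)) c" using s t u by auto
    have "eq_at c (?S \<cdot> s \<cdot> t \<cdot> u) (s \<cdot> u \<cdot> (t \<cdot> u)) \<in> H"
      using s t u ty by (intro axiom_mem EPRA.CS wff_eq_at)
    then have "cls (?S \<cdot> s \<cdot> t \<cdot> u) = cls (s \<cdot> u \<cdot> (t \<cdot> u))"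
      using cls_eq ty by (simp only: eqv_def simp_thms)
    moreover have "term_ap (cls ?S) (cls s) = cls (?S \<cdot> s)" using s by (intro ap_cls) auto
    moreover have "term_ap (cls (?S \<cdot> s)) (cls t) = cls (?S \<cdot> s \<cdot> t)" using ty t by (intro ap_cls)
    moreover have "term_ap (cls (?S \<cdot> s \<cdot> t)) (cls u) = cls (?S \<cdot> s \<cdot> t \<cdot> u)" using ty u by (intro ap_cls)
    moreover have "term_ap (cls s) (cls u) = cls (s \<cdot> u)" using s u by (intro ap_cls)
    moreover have "term_ap (cls t) (cls u) = cls (t \<cdot> u)" using t u by (intro ap_cls)
    moreover have "term_ap (cls (s \<cdot> u)) (cls (t \<cdot> u)) = cls (s \<cdot> u \<cdot> (t \<cdot> u))" using ty by (intro ap_cls)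
    ultimately show "term_ap (term_ap (term_ap (cls ?S) x) y) z = term_ap (term_ap x z) (term_ap y z)"
      using s t u by simp
  }
next
  have R0: "term_ap (term_ap (term_ap (cls R0) (cls n)) (cls s)) (cls z) = cls (R0 \<cdot> n \<cdot> s \<cdot> z)"
    "has_ty [] (R0 \<cdot> n \<cdot> s \<cdot> z) Tp0"
    if ty: "has_ty [] n Tp0" "has_ty [] s Tp0" "has_ty [] z (Tp0 \<rightarrow> Tp0 \<rightarrow> Tp0)" for n s z
  proof -
    let ?Z = "(Tp0 \<rightarrow> Tp0 \<rightarrow> Tp0) \<rightarrow> Tp0"
    have "has_ty [] (R0 \<cdot> n) (Tp0 \<rightarrow> ?Z)" "has_ty [] (R0 \<cdot> n \<cdot> s) ?Z" "has_ty [] (R0 \<cdot> n \<cdot> s \<cdot> z) Tp0"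
      using ty by auto
    moreover have "term_ap (cls R0) (cls n) = cls (R0 \<cdot> n)" using ty by (intro ap_cls) auto
    moreover have "term_ap (cls (R0 \<cdot> n)) (cls s) = cls (R0 \<cdot> n \<cdot> s)" using calculation ty by (intro ap_cls)
    moreover have "term_ap (cls (R0 \<cdot> n \<cdot> s)) (cls z) = cls (R0 \<cdot> n \<cdot> s \<cdot> z)" using calculation ty by (intro ap_cls)
    ultimately show "term_ap (term_ap (term_ap (cls R0) (cls n)) (cls s)) (cls z) = cls (R0 \<cdot> n \<cdot> s \<cdot> z)"
      "has_ty [] (R0 \<cdot> n \<cdot> s \<cdot> z) Tp0" by simp_all
  qed
  have Sc: "term_ap (cls Sc) (cls n) = cls (Sc \<cdot> n)" if "has_ty [] n Tp0" for n
    using that by (intro ap_cls[where a = Tp0]) auto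
  fix n x y z
  {
    assume "x \<in> term_Dom Tp0" "z \<in> term_Dom (Tp0 \<rightarrow> Tp0 \<rightarrow> Tp0)"
    then obtain s t where s: "x = cls s" "has_ty [] s Tp0" and t: "z = cls t" "has_ty [] t (Tp0 \<rightarrow> Tp0 \<rightarrow> Tp0)"
      by (auto simp: term_Dom_def)
    have ty: "has_ty [] (R0 \<cdot> Zero \<cdot> s \<cdot> t) Tp0" using s t by (intro R0) auto
    then have "(R0 \<cdot> Zero \<cdot> s \<cdot> t \<^bold>= s) \<in> H" using s t
      by (intro axiom_mem EPRA.R0_Zero) (simp_all only: wff.simps simp_thms)
    then have "cls (R0 \<cdot> Zero \<cdot> s \<cdot> t) = cls s" using cls_eq ty s by (simp only: eqv_def eq_at.simps simp_thms)
    then show "term_ap (term_ap (term_ap (cls R0) (cls Zero)) x) z = x"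
      using R0(1)[of Zero s t] s t by simp
  next
    assume "n \<in> term_Dom Tp0" "x \<in> term_Dom Tp0" "z \<in> term_Dom (Tp0 \<rightarrow> Tp0 \<rightarrow> Tp0)"
    then obtain s t u where s: "x = cls s" "has_ty [] s Tp0" and t: "z = cls t" "has_ty [] t (Tp0 \<rightarrow> Tp0 \<rightarrow> Tp0)"
      and u: "n = cls u" "has_ty [] u Tp0"
      by (auto simp: term_Dom_def)
    have Su: "has_ty [] (Sc \<cdot> u) Tp0" using u by simp
    have ty: "has_ty [] (R0 \<cdot> (Sc \<cdot> u) \<cdot> s \<cdot> t) Tp0" "has_ty [] (R0 \<cdot> u \<cdot> s \<cdot> t) Tp0"
      by (rule R0(2)[OF Su s(2) t(2)], rule R0(2)[OF u(2) s(2) t(2)])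
    then have ty2: "has_ty [] (t \<cdot> (R0 \<cdot> u \<cdot> s \<cdot> t)) Tp1" "has_ty [] (t \<cdot> (R0 \<cdot> u \<cdot> s \<cdot> t) \<cdot> u) Tp0"
      using t u by auto
    have "(R0 \<cdot> (Sc \<cdot> u) \<cdot> s \<cdot> t \<^bold>= t \<cdot> (R0 \<cdot> u \<cdot> s \<cdot> t) \<cdot> u) \<in> H" using s t u ty ty2
      by (intro axiom_mem EPRA.R0_Sc) (simp_all only: wff.simps simp_thms)
    then have "cls (R0 \<cdot> (Sc \<cdot> u) \<cdot> s \<cdot> t) = cls (t \<cdot> (R0 \<cdot> u \<cdot> s \<cdot> t) \<cdot> u)"
      using cls_eq ty ty2 by (simp only: eqv_def eq_at.simps simp_thms)
    moreover have "term_ap (cls t) (cls (R0 \<cdot> u \<cdot> s \<cdot> t)) = cls (t \<cdot> (R0 \<cdot> u \<cdot> s \<cdot> t))"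
      using t ty by (intro ap_cls)
    moreover have "term_ap (cls (t \<cdot> (R0 \<cdot> u \<cdot> s \<cdot> t))) (cls u) = cls (t \<cdot> (R0 \<cdot> u \<cdot> s \<cdot> t) \<cdot> u)"
      using u ty2 by (intro ap_cls)
    ultimately show "term_ap (term_ap (term_ap (cls R0) (term_ap (cls Sc) n)) x) z =
        term_ap (term_ap z (term_ap (term_ap (term_ap (cls R0) n) x) z)) n"
      using R0(1)[OF Su s(2) t(2)] R0(1)[OF u(2) s(2) t(2)] s t u by (simp add: Sc)
  next
    assume "x \<in> term_Dom Tp0"
    then obtain s where s: "x = cls s" "has_ty [] s Tp0" by (auto simp: term_Dom_def)
    have "(\<^bold>\<not> (Sc \<cdot> s \<^bold>= Zero)) \<in> H" using s by (intro axiom_mem EPRA.Sc_not_Zero) auto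
    then have "\<not> eqv Tp0 (Sc \<cdot> s) Zero" using s by (auto simp: eqv_def neg_mem)
    then show "term_ap (cls Sc) x \<noteq> cls Zero" using s cls_eq[of "Sc \<cdot> s" Tp0 Zero] by (simp add: Sc)
  next
    assume "x \<in> term_Dom Tp0" "y \<in> term_Dom Tp0" and eq: "term_ap (cls Sc) x = term_ap (cls Sc) y"
    then obtain s t where s: "x = cls s" "has_ty [] s Tp0" and t: "y = cls t" "has_ty [] t Tp0"
      by (auto simp: term_Dom_def)
    have "(Sc \<cdot> s \<^bold>= Sc \<cdot> t \<^bold>\<longrightarrow> s \<^bold>= t) \<in> H" using s t by (intro axiom_mem EPRA.Sc_inject) auto
    moreover have "(Sc \<cdot> s \<^bold>= Sc \<cdot> t) \<in> H"
      using eq s t cls_eq[of "Sc \<cdot> s" Tp0 "Sc \<cdot> t"] by (simp add: Sc eqv_def)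
    ultimately have "eqv Tp0 s t" using s t by (simp add: eqv_def Imp_mem)
    then show "x = y" using s t by (simp add: cls_eq)
  }
qed (auto intro: cls_Dom term_induct)

lemma tval_canonical: "has_ty [] t a \<Longrightarrow> M.tval (\<lambda>v. cls (FVar v)) [] t = cls t"
  by (induction t arbitrary: a) (auto simp: ap_cls)

text \<open>An instance of a quantified body is not a subformula, so the truth lemma needs a measure
  that instantiation leaves unchanged.\<close>

primrec complexity :: "fm \<Rightarrow> nat" where
  "complexity Bot = 0"
| "complexity (s \<^bold>= t) = 0"
| "complexity (p \<^bold>\<longrightarrow> q) = Suc (complexity p + complexity q)"
| "complexity (Forall r p) = Suc (complexity p)"

lemma complexity_inst: "complexity (inst k u p) = complexity p"
  by (induction p arbitrary: k) auto

lemma truth: "wff [] p \<Longrightarrow> M.sat (\<lambda>v. cls (FVar v)) [] p \<longleftrightarrow> p \<in> H"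
proof (induction p rule: measure_induct_rule[where f = complexity])
  case (less p)
  let ?e = "\<lambda>v. cls (FVar v)"
  show ?case
  proof (cases p)
    case Bot
    then show ?thesis by (simp add: Bot_mem)
  next
    case (Eq s t)
    then show ?thesis using less.prems
      by (simp add: tval_canonical[where a = Tp0] cls_eq[where a = Tp0] eqv_def)
  next
    case (Imp q r)
    then show ?thesis using less by (simp add: Imp_mem)
  next
    case (Forall r q)
    have q: "wff [r] q" using less.prems Forall by simp
    have "M.sat ?e [cls t] q \<longleftrightarrow> inst 0 t q \<in> H" if t: "has_ty [] t r" for t
    proof -
      have "M.sat ?e [cls t] q \<longleftrightarrow> M.sat ?e [] (inst 0 t q)"
        using M.sat_inst[of "[]" r q t "[]" ?e] q t by (simp add: tval_canonical)
      also have "\<dots> \<longleftrightarrow> inst 0 t q \<in> H"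
        using less.IH[of "inst 0 t q"] wff_inst0[OF q t] Forall by (simp add: complexity_inst)
      finally show ?thesis .
    qed
    then show ?thesis using Forall q by (simp add: Forall_mem) (simp add: term_Dom_def)
  qed
qed

end

text \<open>An unprovable \<open>p\<close> is refuted in the term model of a maximal consistent set
  containing its negation. The carrier type is fixed to classes of terms, since a HOL statement
  cannot quantify over types.\<close>

theorem completeness:
  assumes "EPRA \<subseteq> T" "wff [] p"
    and valid: "\<And>(Dom :: ty \<Rightarrow> tm set set) ap cn e. model Dom ap cn \<Longrightarrow>
      (\<And>v. e v \<in> Dom (snd v)) \<Longrightarrow> applicative.sat Dom ap cn e [] p"
  shows "T \<turnstile> p"
proof (rule ccontr)
  assume "\<not> T \<turnstile> p"
  obtain H where "henkin T H" and H: "(\<^bold>\<not> p) \<in> H"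
  proof (rule lindenbaum[OF assms(2) \<open>\<not> T \<turnstile> p\<close>])
    fix H assume "(\<^bold>\<not> p) \<in> H" "consistent T H"
      "\<And>p. wff [] p \<Longrightarrow> consistent T (insert p H) \<Longrightarrow> p \<in> H"
      "\<And>r q. (\<^bold>\<not> Forall r q) \<in> H \<Longrightarrow> wff [r] q \<Longrightarrow> \<exists>v. snd v = r \<and> (\<^bold>\<not> inst 0 (FVar v) q) \<in> H"
    then show thesis using assms(1) by (intro that henkin.intro)
  qed
  then interpret henkin T H by simp
  have "M.sat (\<lambda>v. cls (FVar v)) [] p"
    by (rule valid) (auto intro: cls_Dom M.model_axioms)
  then show False using truth[OF assms(2)] neg_mem[OF assms(2)] H by simp
qed

section \<open>Reasoning in a model\<close>

subsection \<open>Typing of the defined terms\<close>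

lemma ty_of_has_ty: "has_ty [] t a \<Longrightarrow> ty_of t = a"
  by (induction t arbitrary: a) fastforce+

lemma has_ty_lam: "has_ty [] t b \<Longrightarrow> has_ty [] (lam v t) (snd v \<rightarrow> b)"
proof (induction t arbitrary: b)
  case (App s t)
  then obtain a where s: "has_ty [] s (a \<rightarrow> b)" and t: "has_ty [] t a" by auto
  then show ?case using App.IH(1)[OF s] App.IH(2)[OF t] ty_of_has_ty[OF s] ty_of_has_ty[OF t] by simp
qed auto

lemma fv_lam [simp]: "fv_tm (lam v t) = fv_tm t - {v}"
  by (induction t) auto

declare lam.simps [simp del]

abbreviation r_var :: tm where "r_var \<equiv> FVar (v0 ''r'')"
abbreviation i_var :: tm where "i_var \<equiv> FVar (v0 ''i'')"
abbreviation step :: "tm \<Rightarrow> tm" where "step t \<equiv> lam (v0 ''r'') (lam (v0 ''i'') t)"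

text \<open>The equivalence form lets the simplifier solve the hidden argument type in the typing of
  an application; uniqueness of types gives the forward direction.\<close>

lemma has_ty_step: "has_ty [] t Tp0 \<Longrightarrow> has_ty [] (step t) b \<longleftrightarrow> b = Tp0 \<rightarrow> Tp0 \<rightarrow> Tp0"
  using has_ty_lam[of t Tp0 "v0 ''i''"] has_ty_lam[of "lam (v0 ''i'') t" Tp1 "v0 ''r''"] has_ty_unique
  by auto

lemma has_ty_add [simp]:
  "has_ty [] (add s t) b \<longleftrightarrow> b = Tp0 \<and> has_ty [] s Tp0 \<and> has_ty [] t Tp0"
  by (auto simp: add_def has_ty_step)

lemma has_ty_pred [simp]: "has_ty [] (pred s) b \<longleftrightarrow> b = Tp0 \<and> has_ty [] s Tp0"
  by (auto simp: pred_def has_ty_step)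

lemma has_ty_monus [simp]:
  "has_ty [] (monus s t) b \<longleftrightarrow> b = Tp0 \<and> has_ty [] s Tp0 \<and> has_ty [] t Tp0"
  by (auto simp: monus_def has_ty_step)

lemma has_ty_tri [simp]: "has_ty [] (tri s) b \<longleftrightarrow> b = Tp0 \<and> has_ty [] s Tp0"
  by (auto simp: tri_def has_ty_step)

lemma has_ty_pair [simp]:
  "has_ty [] (pair s t) b \<longleftrightarrow> b = Tp0 \<and> has_ty [] s Tp0 \<and> has_ty [] t Tp0"
  by (auto simp: pair_def)

lemma fv_arith [simp]:
  "fv_tm (add s t) = fv_tm s \<union> fv_tm t" "fv_tm (pred s) = fv_tm s"
  "fv_tm (monus s t) = fv_tm s \<union> fv_tm t" "fv_tm (tri s) = fv_tm s"
  "fv_tm (pair s t) = fv_tm s \<union> fv_tm t"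
  by (auto simp: add_def pred_def monus_def tri_def pair_def)

text \<open>Recursion whose step ignores its arguments. The step is built from two \<open>CK\<close>
  instead of \<open>lam\<close>, so variables such as \<open>r_var\<close> occurring in
  \<open>t\<close> are not captured.\<close>

definition ifz :: "tm \<Rightarrow> tm \<Rightarrow> tm \<Rightarrow> tm" where
  "ifz n s t = R0 \<cdot> n \<cdot> s \<cdot> (CK Tp1 Tp0 \<cdot> (CK Tp0 Tp0 \<cdot> t))"

lemma has_ty_ifz [simp]:
  "has_ty [] (ifz n s t) b \<longleftrightarrow> b = Tp0 \<and> has_ty [] n Tp0 \<and> has_ty [] s Tp0 \<and> has_ty [] t Tp0"
  by (auto simp: ifz_def)

lemma fv_ifz [simp]: "fv_tm (ifz n s t) = fv_tm n \<union> fv_tm s \<union> fv_tm t"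
  by (auto simp: ifz_def)

context model
begin

subsection \<open>Abstraction and representable functions\<close>

definition valid :: "(var \<Rightarrow> 'd) \<Rightarrow> bool" where
  "valid e \<longleftrightarrow> (\<forall>v. e v \<in> Dom (snd v))"

lemma valid_upd: "valid e \<Longrightarrow> x \<in> Dom (snd v) \<Longrightarrow> valid (e(v := x))"
  by (auto simp: valid_def)

lemmas cn_Dom = Zero_Dom Sc_Dom CK_Dom CS_Dom R0_Dom

lemma tval_Dom: "has_ty [] t a \<Longrightarrow> valid e \<Longrightarrow> tval e [] t \<in> Dom a"
  by (induction t arbitrary: a) (auto simp: cn_Dom valid_def intro: ap_Dom)

text \<open>The beta law, from the K and S laws; the identity arises as S applied to two K. Those
  laws hold only inside the domains, so every part must be known to evaluate into its
  domain.\<close>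

lemma tval_lam:
  "has_ty [] t b \<Longrightarrow> valid e \<Longrightarrow> x \<in> Dom (snd v) \<Longrightarrow> tval e [] (lam v t) \<bullet> x = tval (e(v := x)) [] t"
proof (induction t arbitrary: b)
  case (FVar w)
  let ?a = "snd v"
  show ?case
  proof (cases "w = v")
    case True
    have "cn (CK ?a (?a \<rightarrow> ?a)) \<bullet> x \<bullet> (cn (CK ?a ?a) \<bullet> x) = x"
      using FVar CK_Dom by (intro CK_ap ap_Dom)
    then show ?thesis using FVar True
      by (simp add: lam.simps CS_ap[OF CK_Dom CK_Dom])
  next
    case False
    then show ?thesis using FVar False by (simp add: lam.simps CK_ap valid_def del: split_paired_All)
  qed
next
  case (App s t)
  then obtain a where s: "has_ty [] s (a \<rightarrow> b)" and t: "has_ty [] t a" by auto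
  have "tval e [] (lam v s) \<in> Dom (snd v \<rightarrow> a \<rightarrow> b)" "tval e [] (lam v t) \<in> Dom (snd v \<rightarrow> a)"
    using s t App.prems by (auto intro: tval_Dom has_ty_lam)
  then show ?case using App.IH(1)[OF s] App.IH(2)[OF t] App.prems(2,3)
    by (simp add: lam.simps ty_of_has_ty[OF s] ty_of_has_ty[OF t] CS_ap)
qed (auto simp: lam.simps CK_ap cn_Dom)

lemma tval_cong: "(\<And>v. v \<in> fv_tm t \<Longrightarrow> e v = e' v) \<Longrightarrow> tval e D t = tval e' D t"
  by (induction t) auto

lemma tval_upd_fresh [simp]: "v \<notin> fv_tm t \<Longrightarrow> tval (e(v := x)) D t = tval e D t"
  by (rule tval_cong) auto

lemma Dom_nonempty: "\<exists>x. x \<in> Dom a"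
proof (induction a)
  case (Arr a b)
  then obtain y where "y \<in> Dom b" by blast
  then have "cn (CK b a) \<bullet> y \<in> Dom (a \<rightarrow> b)" using CK_Dom ap_Dom by blast
  then show ?case by blast
qed (use Zero_Dom in blast)

text \<open>Some valid assignment is needed to give closed step terms a value;
  \<open>tval_recur\<close> shows that any other would give the same one.\<close>

definition e0 :: "var \<Rightarrow> 'd" where "e0 v = (SOME x. x \<in> Dom (snd v))"

lemma valid_e0: "valid e0"
  by (simp add: valid_def e0_def Dom_nonempty some_in_eq ex_in_conv[symmetric] someI_ex)

lemma tval_step:
  assumes "has_ty [] t Tp0" "valid e" "x \<in> Dom Tp0" "y \<in> Dom Tp0"
  shows "tval e [] (step t) \<bullet> x \<bullet> y = tval (e(v0 ''r'' := x, v0 ''i'' := y)) [] t"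
  using assms tval_lam[of "lam (v0 ''i'') t" Tp1 e x "v0 ''r''"]
    tval_lam[of t Tp0 "e(v0 ''r'' := x)" y "v0 ''i''"] has_ty_lam[of t Tp0 "v0 ''i''"]
  by (simp add: valid_upd)

lemma step_Dom: "has_ty [] t Tp0 \<Longrightarrow> valid e \<Longrightarrow> tval e [] (step t) \<in> Dom (Tp0 \<rightarrow> Tp0 \<rightarrow> Tp0)"
  by (intro tval_Dom) (simp_all add: has_ty_step)

text \<open>Functions of HOL realised by an element of the model. Its closure rules certify, without
  writing terms, that a predicate qualifies for induction.\<close>

definition repr :: "ty \<Rightarrow> ty \<Rightarrow> ('d \<Rightarrow> 'd) \<Rightarrow> bool" where
  "repr a b h \<longleftrightarrow> (\<exists>F\<in>Dom (a \<rightarrow> b). \<forall>x\<in>Dom a. F \<bullet> x = h x)"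

lemma repr_const: "c \<in> Dom b \<Longrightarrow> repr a b (\<lambda>x. c)"
  unfolding repr_def by (rule bexI[of _ "cn (CK b a) \<bullet> c"]) (auto simp: CK_ap intro: ap_Dom[OF CK_Dom])

lemma repr_ap: "repr a (b \<rightarrow> c) f \<Longrightarrow> repr a b g \<Longrightarrow> repr a c (\<lambda>x. f x \<bullet> g x)"
proof -
  assume "repr a (b \<rightarrow> c) f" "repr a b g"
  then obtain F G where F: "F \<in> Dom (a \<rightarrow> b \<rightarrow> c)" "\<forall>x\<in>Dom a. F \<bullet> x = f x"
    and G: "G \<in> Dom (a \<rightarrow> b)" "\<forall>x\<in>Dom a. G \<bullet> x = g x" unfolding repr_def by blast
  have "cn (CS a b c) \<bullet> F \<bullet> G \<in> Dom (a \<rightarrow> c)" using F G CS_Dom ap_Dom by blast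
  moreover have "\<forall>x\<in>Dom a. cn (CS a b c) \<bullet> F \<bullet> G \<bullet> x = f x \<bullet> g x" using F G by (simp add: CS_ap)
  ultimately show ?thesis unfolding repr_def by blast
qed

lemma repr_id: "repr a a (\<lambda>x. x)"
proof -
  have "tval e0 [] (lam (u, a) (FVar (u, a))) \<in> Dom (a \<rightarrow> a)" for u
    using has_ty_lam[of "FVar (u, a)" a "(u, a)"] by (intro tval_Dom valid_e0) simp
  moreover have "tval e0 [] (lam (u, a) (FVar (u, a))) \<bullet> x = x" if "x \<in> Dom a" for x u
    using tval_lam[of "FVar (u, a)" a e0 x "(u, a)"] that valid_e0 by simp
  ultimately show ?thesis unfolding repr_def by blast
qed

lemma repr_ap1: "F \<in> Dom (b \<rightarrow> c) \<Longrightarrow> repr a b g \<Longrightarrow> repr a c (\<lambda>x. F \<bullet> g x)"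
  by (rule repr_ap[OF repr_const])

text \<open>Agreement is demanded on numbers only, because \<open>repr\<close> says nothing about
  application outside the domain.\<close>

definition qfp :: "('d \<Rightarrow> bool) \<Rightarrow> bool" where
  "qfp P \<longleftrightarrow> (\<exists>Q. qf_pred Q \<and> (\<forall>x\<in>Dom Tp0. P x = Q x))"

lemma qfp_eq: "repr Tp0 Tp0 f \<Longrightarrow> repr Tp0 Tp0 g \<Longrightarrow> qfp (\<lambda>x. f x = g x)"
proof -
  assume "repr Tp0 Tp0 f" "repr Tp0 Tp0 g"
  then obtain F G where "F \<in> Dom Tp1" "\<forall>x\<in>Dom Tp0. F \<bullet> x = f x"
    "G \<in> Dom Tp1" "\<forall>x\<in>Dom Tp0. G \<bullet> x = g x" unfolding repr_def by blast
  then show ?thesis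
    unfolding qfp_def by (intro exI[of _ "\<lambda>x. F \<bullet> x = G \<bullet> x"]) (auto intro: qf_Eq)
qed

lemma qfp_imp: "qfp P \<Longrightarrow> qfp Q \<Longrightarrow> qfp (\<lambda>x. P x \<longrightarrow> Q x)"
  unfolding qfp_def by (blast intro: qf_Imp)

lemma qfp_False: "qfp (\<lambda>x. False)"
  unfolding qfp_def by (blast intro: qf_Bot)

lemma qfp_not: "qfp P \<Longrightarrow> qfp (\<lambda>x. \<not> P x)"
  using qfp_imp[OF _ qfp_False] by simp

lemma qfp_disj: "qfp P \<Longrightarrow> qfp Q \<Longrightarrow> qfp (\<lambda>x. P x \<or> Q x)"
  using qfp_imp[OF qfp_not] by (simp add: imp_conv_disj)

lemma induct0 [consumes 1, case_names qfp 0 S]: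
  assumes x: "x \<in> Dom Tp0" and "qfp P" and 0: "P (cn Zero)"
    and S: "\<And>x. x \<in> Dom Tp0 \<Longrightarrow> P x \<Longrightarrow> P (cn Sc \<bullet> x)"
  shows "P x"
proof -
  obtain Q where Q: "qf_pred Q" "\<forall>x\<in>Dom Tp0. P x = Q x" using assms(2) unfolding qfp_def by blast
  have "Q x" using x
  proof (rule induct[OF Q(1), rotated 2])
    show "Q (cn Zero)" using Q(2) 0 Zero_Dom by blast
    show "Q (cn Sc \<bullet> x)" if "x \<in> Dom Tp0" "Q x" for x
      using Q(2) S that ap_Dom[OF Sc_Dom] by blast
  qed
  then show ?thesis using Q(2) x by blast
qed

subsection \<open>Arithmetic in a model\<close>

abbreviation N :: "'d set" where "N \<equiv> Dom Tp0"
abbreviation zero :: 'd ("\<zero>") where "\<zero> \<equiv> cn Zero"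
abbreviation Suc' :: "'d \<Rightarrow> 'd" ("\<S>") where "\<S> x \<equiv> cn Sc \<bullet> x"

definition recur :: "'d \<Rightarrow> 'd \<Rightarrow> tm \<Rightarrow> 'd" where
  "recur n x t = cn R0 \<bullet> n \<bullet> x \<bullet> tval e0 [] (step t)"

definition madd :: "'d \<Rightarrow> 'd \<Rightarrow> 'd" (infixl "\<oplus>" 65) where
  "x \<oplus> y = recur x y (Sc \<cdot> r_var)"
definition mpred :: "'d \<Rightarrow> 'd" where
  "mpred x = recur x \<zero> i_var"
definition mmonus :: "'d \<Rightarrow> 'd \<Rightarrow> 'd" (infixl "\<ominus>" 65) where
  "x \<ominus> y = recur y x (pred r_var)"
definition mtri :: "'d \<Rightarrow> 'd" where
  "mtri x = recur x \<zero> (Sc \<cdot> add r_var i_var)"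
definition mpair :: "'d \<Rightarrow> 'd \<Rightarrow> 'd" where
  "mpair x y = mtri (x \<oplus> y) \<oplus> x"

lemma Zero_N [simp]: "\<zero> \<in> N" by (rule Zero_Dom)
lemma S_N [simp]: "x \<in> N \<Longrightarrow> \<S> x \<in> N" by (rule ap_Dom[OF Sc_Dom])
lemma S_neq [simp]: "x \<in> N \<Longrightarrow> \<S> x \<noteq> \<zero>" "x \<in> N \<Longrightarrow> \<zero> \<noteq> \<S> x"
  using Sc_neq_Zero by metis+
lemma S_inj [simp]: "x \<in> N \<Longrightarrow> y \<in> N \<Longrightarrow> \<S> x = \<S> y \<longleftrightarrow> x = y"
  using Sc_inj by blast
lemma ap_N [simp]: "F \<in> Dom Tp1 \<Longrightarrow> x \<in> N \<Longrightarrow> F \<bullet> x \<in> N" by (rule ap_Dom)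

lemma R0_N: "n \<in> N \<Longrightarrow> x \<in> N \<Longrightarrow> z \<in> Dom (Tp0 \<rightarrow> Tp0 \<rightarrow> Tp0) \<Longrightarrow> cn R0 \<bullet> n \<bullet> x \<bullet> z \<in> N"
  using R0_Dom ap_Dom by blast

lemma recur_N: "has_ty [] t Tp0 \<Longrightarrow> n \<in> N \<Longrightarrow> x \<in> N \<Longrightarrow> recur n x t \<in> N"
  unfolding recur_def by (intro R0_N step_Dom valid_e0)

lemma recur_Zero: "has_ty [] t Tp0 \<Longrightarrow> x \<in> N \<Longrightarrow> recur \<zero> x t = x"
  unfolding recur_def by (intro R0_Zero_ap step_Dom valid_e0)

lemma recur_S:
  "has_ty [] t Tp0 \<Longrightarrow> n \<in> N \<Longrightarrow> x \<in> N \<Longrightarrow>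
    recur (\<S> n) x t = tval (e0(v0 ''r'' := recur n x t, v0 ''i'' := n)) [] t"
  using R0_Sc_ap[OF _ _ step_Dom[OF _ valid_e0], of n x t] tval_step[OF _ valid_e0 recur_N, of t t n x n]
  by (simp add: recur_def)

lemma tval_recur:
  "has_ty [] t Tp0 \<Longrightarrow> fv_tm (step t) = {} \<Longrightarrow>
    tval e D (R0 \<cdot> n \<cdot> s \<cdot> step t) = recur (tval e D n) (tval e D s) t"
  using tval_closed[of "step t" _ e D] tval_cong[of "step t" e e0 "[]"]
  by (simp add: recur_def has_ty_step del: fv_lam)

lemma tval_add [simp]: "tval e D (add s t) = tval e D s \<oplus> tval e D t"
  unfolding add_def madd_def by (rule tval_recur) auto

lemma tval_pred [simp]: "tval e D (pred s) = mpred (tval e D s)"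
  unfolding pred_def mpred_def by (subst tval_recur) auto

lemma tval_monus [simp]: "tval e D (monus s t) = tval e D s \<ominus> tval e D t"
  unfolding monus_def mmonus_def by (rule tval_recur) auto

lemma tval_tri [simp]: "tval e D (tri s) = mtri (tval e D s)"
  unfolding tri_def mtri_def by (subst tval_recur) auto

lemma tval_pair [simp]: "tval e D (pair s t) = mpair (tval e D s) (tval e D t)"
  by (simp add: pair_def mpair_def)

lemma arith_N [simp]:
  "x \<in> N \<Longrightarrow> y \<in> N \<Longrightarrow> x \<oplus> y \<in> N" "x \<in> N \<Longrightarrow> mpred x \<in> N"
  "x \<in> N \<Longrightarrow> y \<in> N \<Longrightarrow> x \<ominus> y \<in> N" "x \<in> N \<Longrightarrow> mtri x \<in> N"
  "x \<in> N \<Longrightarrow> y \<in> N \<Longrightarrow> mpair x y \<in> N"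
  by (simp_all add: madd_def mpred_def mmonus_def mtri_def mpair_def recur_N)

lemma add_rec [simp]: "y \<in> N \<Longrightarrow> \<zero> \<oplus> y = y" "x \<in> N \<Longrightarrow> y \<in> N \<Longrightarrow> \<S> x \<oplus> y = \<S> (x \<oplus> y)"
  by (simp_all add: madd_def recur_Zero recur_S)

lemma pred_rec [simp]: "mpred \<zero> = \<zero>" "x \<in> N \<Longrightarrow> mpred (\<S> x) = x"
  by (simp_all add: mpred_def recur_Zero recur_S)

lemma monus_rec: "x \<in> N \<Longrightarrow> x \<ominus> \<zero> = x" "x \<in> N \<Longrightarrow> y \<in> N \<Longrightarrow> x \<ominus> \<S> y = mpred (x \<ominus> y)"
  by (simp_all add: mmonus_def recur_Zero recur_S)

lemma tri_rec [simp]: "mtri \<zero> = \<zero>" "x \<in> N \<Longrightarrow> mtri (\<S> x) = \<S> (mtri x \<oplus> x)"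
  by (simp_all add: mtri_def recur_Zero recur_S)

lemma repr_recur:
  "has_ty [] t Tp0 \<Longrightarrow> repr a Tp0 f \<Longrightarrow> repr a Tp0 g \<Longrightarrow> repr a Tp0 (\<lambda>x. recur (f x) (g x) t)"
  unfolding recur_def
  by (intro repr_ap[OF repr_ap[OF repr_ap[OF repr_const[OF R0_Dom]]]] repr_const[OF step_Dom] valid_e0)

lemma repr_arith:
  "repr a Tp0 f \<Longrightarrow> repr a Tp0 g \<Longrightarrow> repr a Tp0 (\<lambda>x. f x \<oplus> g x)"
  "repr a Tp0 f \<Longrightarrow> repr a Tp0 (\<lambda>x. mpred (f x))"
  "repr a Tp0 f \<Longrightarrow> repr a Tp0 g \<Longrightarrow> repr a Tp0 (\<lambda>x. f x \<ominus> g x)"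
  "repr a Tp0 f \<Longrightarrow> repr a Tp0 (\<lambda>x. mtri (f x))"
  "repr a Tp0 f \<Longrightarrow> repr a Tp0 (\<lambda>x. \<S> (f x))"
  by (simp_all add: madd_def mpred_def mmonus_def mtri_def repr_recur repr_const repr_ap1[OF Sc_Dom])

lemmas qfp_intros = qfp_eq qfp_imp qfp_False qfp_not qfp_disj repr_arith repr_id repr_const
  repr_ap1[where b = Tp0 and c = Tp0]

section \<open>Laws of addition\<close>

lemma add_Zero_right [simp]: "x \<in> N \<Longrightarrow> x \<oplus> \<zero> = x"
  by (induction x rule: induct0) (auto intro!: qfp_intros)

lemma add_S_right [simp]:
  assumes "x \<in> N" "y \<in> N"
  shows "x \<oplus> \<S> y = \<S> (x \<oplus> y)"
  using assms(1) by (induction x rule: induct0) (use assms in \<open>auto intro!: qfp_intros\<close>)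

lemma add_comm:
  assumes "x \<in> N" "y \<in> N"
  shows "x \<oplus> y = y \<oplus> x"
  using assms(1) by (induction x rule: induct0) (use assms in \<open>auto intro!: qfp_intros\<close>)

lemma add_assoc:
  assumes "x \<in> N" "y \<in> N" "z \<in> N"
  shows "x \<oplus> y \<oplus> z = x \<oplus> (y \<oplus> z)"
  using assms(1) by (induction x rule: induct0) (use assms in \<open>auto intro!: qfp_intros\<close>)

lemma add_cancel [simp]:
  assumes "x \<in> N" "y \<in> N" "z \<in> N"
  shows "x \<oplus> y = x \<oplus> z \<longleftrightarrow> y = z"
proof -
  have "x \<oplus> y = x \<oplus> z \<longrightarrow> y = z"
    using assms(1) by (induction x rule: induct0) (use assms in \<open>auto intro!: qfp_intros\<close>)
  then show ?thesis by blast
qed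

text \<open>Having a predecessor is existential, so the induction is on the equation with
  \<open>mpred\<close> as explicit witness.\<close>

lemma N_cases:
  assumes "x \<in> N"
  obtains "x = \<zero>" | y where "y \<in> N" "x = \<S> y"
proof -
  have "x = \<zero> \<or> x = \<S> (mpred x)"
    using assms by (induction x rule: induct0) (auto intro!: qfp_intros)
  then show thesis using that assms arith_N(2) by blast
qed

section \<open>Truncated subtraction and the order of the numbers\<close>

lemma Zero_monus [simp]: "y \<in> N \<Longrightarrow> \<zero> \<ominus> y = \<zero>"
  by (induction y rule: induct0) (auto simp: monus_rec intro!: qfp_intros)

lemma S_monus_S [simp]:
  assumes "x \<in> N" "y \<in> N"
  shows "\<S> x \<ominus> \<S> y = x \<ominus> y"
  using assms(2) by (induction y rule: induct0) (use assms in \<open>auto simp: monus_rec intro!: qfp_intros\<close>)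

lemma add_monus [simp]:
  assumes "x \<in> N" "y \<in> N"
  shows "x \<oplus> y \<ominus> x = y"
  using assms(1) by (induction x rule: induct0) (use assms in \<open>auto simp: monus_rec(1) intro!: qfp_intros\<close>)

lemma monus_add [simp]:
  assumes "x \<in> N" "y \<in> N"
  shows "x \<ominus> (x \<oplus> y) = \<zero>"
  using assms(1) by (induction x rule: induct0) (use assms in \<open>auto simp: monus_rec(1) intro!: qfp_intros\<close>)

lemma monus_self [simp]: "x \<in> N \<Longrightarrow> x \<ominus> x = \<zero>"
  using monus_add[of x \<zero>] by simp

text \<open>Comparability asserts the existence of a difference; naming it by truncated subtraction
  makes the disjunction quantifier-free and open to induction. The successor in the second
  alternative keeps the two cases disjoint.\<close>

lemma N_total:
  assumes x: "x \<in> N" and "y \<in> N"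
  obtains z where "z \<in> N" "y = x \<oplus> z" | z where "z \<in> N" "x = y \<oplus> \<S> z"
proof -
  have "x \<oplus> (y \<ominus> x) = y \<or> y \<oplus> (x \<ominus> y) = x"
    using assms(2)
  proof (induction y rule: induct0)
    case (S y)
    show ?case using S(2)
    proof
      assume eq: "x \<oplus> (y \<ominus> x) = y"
      then have "\<S> y = x \<oplus> \<S> (y \<ominus> x)" using S x by simp
      then have "\<S> y \<ominus> x = \<S> (y \<ominus> x)" using add_monus[of x "\<S> (y \<ominus> x)"] S x by simp
      then show ?thesis using eq S x by simp
    next
      assume eq: "y \<oplus> (x \<ominus> y) = x"
      have "x \<ominus> y \<in> N" using S x by simp
      then show ?thesis
      proof (cases rule: N_cases)
        \<comment> \<open>The boundary case: \<open>x\<close> and \<open>y\<close> coincide, so the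
          successor of \<open>y\<close> exceeds \<open>x\<close> by one and the first disjunct takes
          over.\<close>
        case 1
        then have xy: "x = y" using eq S by simp
        then have "\<S> y \<ominus> x = \<S> \<zero>" using add_monus[of x "\<S> \<zero>"] S x by simp
        then show ?thesis using xy S x by simp
      next
        case (2 u)
        then have "x = \<S> y \<oplus> u" using eq S by simp
        moreover from this have "x \<ominus> \<S> y = u" using add_monus[of "\<S> y" u] S 2 by simp
        ultimately show ?thesis by simp
      qed
    qed
  qed (use x in \<open>auto simp: monus_rec intro!: qfp_intros\<close>)
  then show thesis
  proof
    assume "x \<oplus> (y \<ominus> x) = y"
    then show thesis using that(1)[of "y \<ominus> x"] assms by simp
  next
    assume eq: "y \<oplus> (x \<ominus> y) = x"
    have "x \<ominus> y \<in> N" using assms by simp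
    then show thesis
    proof (cases rule: N_cases)
      case 1
      then show thesis using eq that(1)[of \<zero>] assms by simp
    next
      case (2 u)
      then show thesis using eq that(2)[of u] assms by simp
    qed
  qed
qed

lemma monus_eq_Zero_iff:
  assumes "x \<in> N" "y \<in> N"
  shows "x \<ominus> y = \<zero> \<longleftrightarrow> (\<exists>z\<in>N. y = x \<oplus> z)"
proof
  assume *: "x \<ominus> y = \<zero>"
  from assms show "\<exists>z\<in>N. y = x \<oplus> z"
  proof (cases rule: N_total)
    case (2 z)
    then show ?thesis using * assms add_monus[of y "\<S> z"] by simp
  qed blast
qed (use assms in auto)

lemma eq_test:
  assumes "x \<in> N" "y \<in> N"
  shows "(x \<ominus> y) \<oplus> (y \<ominus> x) = \<zero> \<longleftrightarrow> x = y"
proof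
  assume "x = y"
  then show "(x \<ominus> y) \<oplus> (y \<ominus> x) = \<zero>" using monus_add[of x \<zero>] assms by simp
next
  assume *: "(x \<ominus> y) \<oplus> (y \<ominus> x) = \<zero>"
  from assms show "x = y"
  proof (cases rule: N_total)
    case (1 z)
    then show ?thesis using * assms by simp
  next
    case (2 z)
    then have "x \<ominus> y = \<S> z" using add_monus[of y "\<S> z"] assms by simp
    then show ?thesis using * 2 assms by simp
  qed
qed

text \<open>Diagonals of the pairing do not overlap: diagonal \<open>u\<close> uses the codes from
  \<open>mtri u\<close> to \<open>mtri u \<oplus> u\<close>, and every later one starts beyond
  these. The inequality is inducted on as a vanishing truncated difference.\<close>

lemma tri_gap:
  assumes "u \<in> N" "w \<in> N"
  shows "\<exists>k\<in>N. mtri (u \<oplus> \<S> w) = \<S> (mtri u \<oplus> u) \<oplus> k"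
proof -
  have "\<S> (mtri u \<oplus> u) \<ominus> mtri (u \<oplus> \<S> w) = \<zero>"
    using assms(2)
  proof (induction w rule: induct0)
    case (S w)
    then obtain k where k: "k \<in> N" "mtri (u \<oplus> \<S> w) = \<S> (mtri u \<oplus> u) \<oplus> k"
      using monus_eq_Zero_iff[of "\<S> (mtri u \<oplus> u)" "mtri (u \<oplus> \<S> w)"] assms(1) by auto
    have "mtri (u \<oplus> \<S> (\<S> w)) = \<S> (mtri (u \<oplus> \<S> w) \<oplus> (u \<oplus> \<S> w))"
      using S assms(1) by simp
    also have "\<dots> = \<S> (mtri u \<oplus> u) \<oplus> \<S> (k \<oplus> (u \<oplus> \<S> w))"
      unfolding k(2) using S k(1) assms(1) by (simp add: add_assoc)
    finally show ?case using S k(1) assms(1) by (simp del: add_rec add_S_right)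
  qed (use assms in \<open>auto intro!: qfp_intros\<close>)
  then show ?thesis
    using monus_eq_Zero_iff[of "\<S> (mtri u \<oplus> u)" "mtri (u \<oplus> \<S> w)"] assms by auto
qed

lemma pair_sum_eq:
  assumes N: "s \<in> N" "t \<in> N" "s' \<in> N" "t' \<in> N" and eq: "mpair s t = mpair s' t'"
    and w: "w \<in> N" "s' \<oplus> t' = s \<oplus> t \<oplus> \<S> w"
  shows False
proof -
  obtain k where k: "k \<in> N" "mtri (s' \<oplus> t') = \<S> (mtri (s \<oplus> t) \<oplus> (s \<oplus> t)) \<oplus> k"
    using tri_gap[of "s \<oplus> t" w] N w by auto
  \<comment> \<open>By the gap, \<open>?c\<close> is how far the code of \<open>(s', t')\<close>
    exceeds that of \<open>(s, t)\<close>; being a successor, it cannot vanish.\<close>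
  let ?u = "mtri (s \<oplus> t)" and ?c = "\<S> (t \<oplus> (k \<oplus> s'))"
  have "?u \<oplus> s = \<S> (?u \<oplus> (s \<oplus> (t \<oplus> (k \<oplus> s'))))"
    using eq N k by (simp add: mpair_def add_assoc)
  moreover have "?u \<oplus> (s \<oplus> ?c) = \<S> (?u \<oplus> (s \<oplus> (t \<oplus> (k \<oplus> s'))))" using N k(1) by simp
  ultimately have "?u \<oplus> (s \<oplus> ?c) = ?u \<oplus> s" by (simp only:)
  then have "s \<oplus> ?c = s \<oplus> \<zero>" using N k(1) by (simp del: add_S_right)
  then show False using N k(1) by (simp del: add_S_right add_Zero_right)
qed

lemma pair_inj:
  assumes "s \<in> N" "t \<in> N" "s' \<in> N" "t' \<in> N"
  shows "mpair s t = mpair s' t' \<longleftrightarrow> s = s' \<and> t = t'"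
proof
  assume eq: "mpair s t = mpair s' t'"
  have "s \<oplus> t = s' \<oplus> t'"
  proof (rule N_total[of "s \<oplus> t" "s' \<oplus> t'"])
    fix z assume z: "z \<in> N" "s' \<oplus> t' = s \<oplus> t \<oplus> z"
    from z(1) show ?thesis
    proof (cases rule: N_cases)
      case (2 w)
      then show ?thesis using pair_sum_eq[of s t s' t' w] assms eq z by simp
    qed (use z assms in simp)
  qed (use pair_sum_eq[of s' t' s t] assms eq in auto)
  moreover from this have "s = s'" using eq assms by (simp add: mpair_def)
  ultimately show "s = s' \<and> t = t'" using assms by simp
qed simp

text \<open>Since a triangular number is at least its index, a search up to a pair code always
  reaches the second component.\<close>

lemma snd_le_pair:
  assumes "s \<in> N" "t \<in> N"
  shows "\<exists>k\<in>N. mpair s t = t \<oplus> k"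
proof -
  have "\<exists>k\<in>N. mtri x = x \<oplus> k" if "x \<in> N" for x
    using that
  proof (cases rule: N_cases)
    case (2 y)
    then show ?thesis using add_comm[of "mtri y" y] by (intro bexI[of _ "mtri y"]) auto
  qed (auto intro!: bexI[of _ \<zero>])
  from this[of "s \<oplus> t"] obtain k where "k \<in> N" "mtri (s \<oplus> t) = s \<oplus> t \<oplus> k"
    using assms by auto
  then have "mpair s t = t \<oplus> (s \<oplus> (k \<oplus> s))" "s \<oplus> (k \<oplus> s) \<in> N"
    using assms add_comm[of s t] by (auto simp: mpair_def add_assoc)
  then show ?thesis by blast
qed

lemma tval_ifz [simp]:
  assumes "tval e D n \<in> N" "tval e D s \<in> N" "tval e D t \<in> N"
  shows "tval e D (ifz n s t) = (if tval e D n = \<zero> then tval e D s else tval e D t)"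
proof -
  let ?z = "cn (CK Tp1 Tp0) \<bullet> (cn (CK Tp0 Tp0) \<bullet> tval e D t)"
  have K: "cn (CK Tp0 Tp0) \<bullet> tval e D t \<in> Dom Tp1" using assms ap_Dom[OF CK_Dom] by blast
  then have z: "?z \<in> Dom (Tp0 \<rightarrow> Tp0 \<rightarrow> Tp0)" using ap_Dom[OF CK_Dom] by blast
  have "cn R0 \<bullet> \<S> m \<bullet> tval e D s \<bullet> ?z = tval e D t" if m: "m \<in> N" for m
    using R0_Sc_ap[OF m assms(2) z] R0_N[OF m assms(2) z] m assms K by (simp add: CK_ap)
  moreover have "cn R0 \<bullet> \<zero> \<bullet> tval e D s \<bullet> ?z = tval e D s" by (rule R0_Zero_ap[OF assms(2) z])
  ultimately show ?thesis
    by (rule_tac N_cases[OF assms(1)]) (simp_all add: ifz_def)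
qed

end

lemma wff_leq [simp]: "wff [] (leq s t) \<longleftrightarrow> has_ty [] s Tp0 \<and> has_ty [] t Tp0"
  by (auto simp: leq_def)

lemma wff_rel [simp]: "wff [] (rel X s t) \<longleftrightarrow> has_ty [] X Tp1 \<and> has_ty [] s Tp0 \<and> has_ty [] t Tp0"
  by (auto simp: rel_def)

lemma wff_lin_order: "wff [] (lin_order (FVar (c, Tp1)))"
  by (simp add: lin_order_def is_set_def in_field_def Let_def wff_all_var)

lemma wff_mu_spec: "wff [] mu_spec"
  by (simp add: mu_spec_def Let_def var_mu_def wff_all_var wff_ex_var)

lemma wff_UADS2_spec: "wff [] UADS2_spec"
  by (simp add: UADS2_spec_def Let_def var_Phi_def in_Seq_def in_field_def wff_lin_order wff_all_var wff_ex_var)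

context model
begin

subsection \<open>The two principles in a model\<close>

definition mrel :: "'d \<Rightarrow> 'd \<Rightarrow> 'd \<Rightarrow> bool" where
  "mrel X s t \<longleftrightarrow> X \<bullet> mpair s t = \<S> \<zero>"

definition mlin :: "'d \<Rightarrow> bool" where
  "mlin X \<longleftrightarrow> (\<forall>i\<in>N. X \<bullet> i = \<zero> \<or> X \<bullet> i = \<S> \<zero>) \<and>
     (\<forall>i\<in>N. \<forall>j\<in>N. mrel X i j \<longrightarrow> mrel X i i \<and> mrel X j j) \<and>
     (\<forall>i\<in>N. \<forall>j\<in>N. \<forall>k\<in>N. mrel X i j \<and> mrel X j k \<longrightarrow> mrel X i k) \<and>
     (\<forall>i\<in>N. \<forall>j\<in>N. mrel X i j \<and> mrel X j i \<longrightarrow> i = j) \<and>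
     (\<forall>i\<in>N. \<forall>j\<in>N. mrel X i i \<and> mrel X j j \<longrightarrow> mrel X i j \<or> mrel X j i)"

definition mbounded :: "'d \<Rightarrow> 'd \<Rightarrow> bool" where
  "mbounded X g \<longleftrightarrow> (\<forall>x\<in>Dom Tp1. (\<forall>i\<in>N. mrel X (x \<bullet> i) (x \<bullet> i)) \<longrightarrow>
     (\<exists>n\<in>N. \<exists>k\<in>N. n \<ominus> g \<bullet> x = \<zero> \<and> k \<ominus> g \<bullet> x = \<zero> \<and>
        mrel X (x \<bullet> n) (x \<bullet> \<S> n) \<and> mrel X (x \<bullet> \<S> k) (x \<bullet> k)))"

definition mends :: "'d \<Rightarrow> 'd \<Rightarrow> bool" where
  "mends X c \<longleftrightarrow> (\<exists>a\<in>N. \<exists>b\<in>N. c = mpair a b \<and> (\<forall>m\<in>N. mrel X m m \<longrightarrow> mrel X a m \<and> mrel X m b))"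

definition mUADS2 :: "'d \<Rightarrow> bool" where
  "mUADS2 \<Phi> \<longleftrightarrow> (\<forall>X\<in>Dom Tp1. \<forall>g\<in>Dom Tp2. mlin X \<longrightarrow> mbounded X g \<longrightarrow> mends X (\<Phi> \<bullet> X \<bullet> g))"

definition mmu :: "'d \<Rightarrow> bool" where
  "mmu \<mu> \<longleftrightarrow> (\<forall>f\<in>Dom Tp1. (\<exists>n\<in>N. f \<bullet> n = \<zero>) \<longrightarrow> f \<bullet> (\<mu> \<bullet> f) = \<zero>)"

lemma sat_leq [simp]: "sat e D (leq s t) \<longleftrightarrow> tval e D s \<ominus> tval e D t = \<zero>"
  by (simp add: leq_def)

lemma sat_rel [simp]: "sat e D (rel X s t) \<longleftrightarrow> mrel (tval e D X) (tval e D s) (tval e D t)"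
  by (simp add: rel_def mrel_def)

lemma sat_mu_spec: "sat e [] mu_spec \<longleftrightarrow> mmu (e var_mu)"
  by (simp add: mu_spec_def Let_def var_mu_def wff_all_var wff_ex_var sat_all_var sat_ex_var mmu_def)

lemma sat_lin_order: "sat e [] (lin_order (FVar (c, Tp1))) \<longleftrightarrow> mlin (e (c, Tp1))"
  by (simp add: lin_order_def is_set_def in_field_def Let_def wff_all_var sat_all_var mlin_def
      disj_imp conj_ac del: ball_simps cong del: imp_cong)

lemma sat_UADS2_spec: "sat e [] UADS2_spec \<longleftrightarrow> mUADS2 (e var_Phi)"
  by (simp add: UADS2_spec_def Let_def var_Phi_def in_Seq_def in_field_def wff_lin_order
      wff_all_var wff_ex_var sat_all_var sat_ex_var sat_lin_order mUADS2_def mbounded_def mends_def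
      conj_ac del: ball_simps bex_simps cong del: imp_cong)

subsection \<open>From \<open>\<Phi>\<close> to \<open>\<mu>\<close>\<close>

lemma repr_R0:
  "z \<in> Dom (Tp0 \<rightarrow> Tp0 \<rightarrow> Tp0) \<Longrightarrow> repr a Tp0 f \<Longrightarrow> repr a Tp0 g \<Longrightarrow>
    repr a Tp0 (\<lambda>x. cn R0 \<bullet> f x \<bullet> g x \<bullet> z)"
  by (intro repr_ap[OF repr_ap[OF repr_ap[OF repr_const[OF R0_Dom]]]] repr_const)

text \<open>\<open>L\<close> keeps its value once that value is a zero of \<open>f\<close> and
  otherwise advances, so an unsuccessful \<open>L p\<close> is \<open>p\<close> itself. Minimality
  of \<open>c\<close> is captured by the quantifier-free facts that all successful searches return
  \<open>c\<close> and that every search reaching \<open>c\<close> stays there.\<close>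

lemma first_zero:
  assumes f: "f \<in> Dom Tp1" and z: "z \<in> Dom (Tp0 \<rightarrow> Tp0 \<rightarrow> Tp0)"
    and z_eq: "\<And>r i. r \<in> N \<Longrightarrow> i \<in> N \<Longrightarrow> z \<bullet> r \<bullet> i = (if f \<bullet> r = \<zero> then r else \<S> i)"
    and n: "n \<in> N" "f \<bullet> n = \<zero>"
  defines "L \<equiv> \<lambda>n. cn R0 \<bullet> n \<bullet> \<zero> \<bullet> z"
  obtains c where "c \<in> N" "f \<bullet> c = \<zero>" "\<And>p. p \<in> N \<Longrightarrow> f \<bullet> L p = \<zero> \<Longrightarrow> L p = c"
    "\<And>k. k \<in> N \<Longrightarrow> L (c \<oplus> k) = c"
proof -
  have L_N [simp]: "L p \<in> N" if "p \<in> N" for p unfolding L_def using that z by (intro R0_N) auto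
  have L_Zero: "L \<zero> = \<zero>" unfolding L_def using z by (intro R0_Zero_ap) auto
  have L_S: "L (\<S> p) = (if f \<bullet> L p = \<zero> then L p else \<S> p)" if "p \<in> N" for p
    using R0_Sc_ap[OF that Zero_N z] z_eq[OF L_N[OF that] that] by (simp add: L_def)
  have L_id: "L p = p" if "p \<in> N" "f \<bullet> L p \<noteq> \<zero>" for p
    using that(1) by (rule N_cases) (use that(2) L_Zero L_S in \<open>auto split: if_splits\<close>)
  have L_add: "L (p \<oplus> k) = L p" if p: "p \<in> N" "f \<bullet> L p = \<zero>" and k: "k \<in> N" for p k
    using k
  proof (induction k rule: induct0)
    case qfp
    show ?case unfolding L_def
      by (intro qfp_eq repr_R0[OF z] repr_arith repr_id repr_const R0_N p z Zero_N)
  qed (use p L_S in auto)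
  have L_unique: "L p = L q" if "p \<in> N" "f \<bullet> L p = \<zero>" "q \<in> N" "f \<bullet> L q = \<zero>" for p q
    by (rule N_total[OF that(1,3)]) (use that L_add in \<open>auto simp del: add_S_right\<close>)
  have L_zero: "f \<bullet> L p = \<zero>" if "p \<in> N" "f \<bullet> p = \<zero>" for p
    using L_id[OF that(1)] that(2) by metis
  show thesis
  proof (rule that[of "L n"])
    show c: "L n \<in> N" "f \<bullet> L n = \<zero>" using n L_zero by auto
    show "L p = L n" if "p \<in> N" "f \<bullet> L p = \<zero>" for p
      using L_unique[OF that n(1) c(2)] .
    then have "L (L n) = L n" using c L_zero by blast
    then show "L (L n \<oplus> k) = L n" if "k \<in> N" for k using L_add[of "L n" k] c that by simp
  qed
qed

text \<open>The elements are described by defining equations, which separates the argument from the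
  terms realising it. As the greatest element, \<open>\<S> c\<close> forces the upper bound
  \<open>b\<close> to equal it, and the code of \<open>(a, b)\<close> is large enough for the search
  to return \<open>c\<close>.\<close>

lemma mu_from_Phi:
  assumes \<Phi>: "mUADS2 \<Phi>" and f: "f \<in> Dom Tp1" and z: "z \<in> Dom (Tp0 \<rightarrow> Tp0 \<rightarrow> Tp0)"
    and z_eq: "\<And>r i. r \<in> N \<Longrightarrow> i \<in> N \<Longrightarrow> z \<bullet> r \<bullet> i = (if f \<bullet> r = \<zero> then r else \<S> i)"
  defines "L \<equiv> \<lambda>n. cn R0 \<bullet> n \<bullet> \<zero> \<bullet> z"
  assumes X: "X \<in> Dom Tp1"
    and X_eq: "\<And>p. p \<in> N \<Longrightarrow> X \<bullet> p = (if p = mpair \<zero> \<zero> \<or>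
      f \<bullet> L p = \<zero> \<and> (p = mpair \<zero> (\<S> (L p)) \<or> p = mpair (\<S> (L p)) (\<S> (L p))) then \<S> \<zero> else \<zero>)"
    and g: "g \<in> Dom Tp2" and g_eq: "\<And>x. x \<in> Dom Tp1 \<Longrightarrow> g \<bullet> x = \<S> \<zero>"
    and n: "n \<in> N" "f \<bullet> n = \<zero>"
  shows "f \<bullet> L (\<Phi> \<bullet> X \<bullet> g) = \<zero>"
proof -
  obtain c where c: "c \<in> N" "f \<bullet> c = \<zero>" "\<And>p. p \<in> N \<Longrightarrow> f \<bullet> L p = \<zero> \<Longrightarrow> L p = c"
    "\<And>k. k \<in> N \<Longrightarrow> L (c \<oplus> k) = c"
    unfolding L_def by (rule first_zero[OF f z z_eq n]) blast+
  \<comment> \<open>The code is at least the successor of \<open>c\<close>, so the search up to it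
    has passed \<open>c\<close>.\<close>
  have L_pair: "L (mpair s (\<S> c)) = c" if s: "s \<in> N" for s
  proof -
    obtain k where k: "k \<in> N" "mpair s (\<S> c) = \<S> c \<oplus> k" using snd_le_pair[of s "\<S> c"] s c by auto
    then have "mpair s (\<S> c) = c \<oplus> \<S> k" using c by simp
    then show ?thesis using c(4)[of "\<S> k"] k by simp
  qed
  have rel: "mrel X s t \<longleftrightarrow> s = \<zero> \<and> t = \<zero> \<or> t = \<S> c \<and> (s = \<zero> \<or> s = \<S> c)"
    if st: "s \<in> N" "t \<in> N" for s t
  proof -
    have L_N: "L (mpair s t) \<in> N" unfolding L_def using st z by (intro R0_N) auto
    have "mrel X s t \<longleftrightarrow> s = \<zero> \<and> t = \<zero> \<or>
        f \<bullet> L (mpair s t) = \<zero> \<and> t = \<S> (L (mpair s t)) \<and> (s = \<zero> \<or> s = \<S> (L (mpair s t)))"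
      using st L_N by (auto simp: mrel_def X_eq pair_inj)
    then show ?thesis using c(2) c(3)[of "mpair s t"] L_pair st by auto
  qed
  have "mlin X"
    unfolding mlin_def using c(1) by (auto simp: rel X_eq)
  moreover have "mbounded X g"
    unfolding mbounded_def
  proof (intro ballI impI)
    fix x assume x: "x \<in> Dom Tp1" and field: "\<forall>i\<in>N. mrel X (x \<bullet> i) (x \<bullet> i)"
    then have two: "x \<bullet> i = \<zero> \<or> x \<bullet> i = \<S> c" if "i \<in> N" for i using rel that by auto
    have *: "mrel X (x \<bullet> i) (x \<bullet> j) \<longleftrightarrow> x \<bullet> i = \<zero> \<or> x \<bullet> j = \<S> c" if "i \<in> N" "j \<in> N" for i j
      using two[of i] two[of j] c(1) x that by (auto simp: rel)
    \<comment> \<open>A strict step down lands on \<open>\<zero>\<close> and the step after it is a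
      weak ascent; dually, a strict step up lands on the top and a weak descent follows.\<close>
    have "\<exists>n\<in>{\<zero>, \<S> \<zero>}. \<exists>k\<in>{\<zero>, \<S> \<zero>}. mrel X (x \<bullet> n) (x \<bullet> \<S> n) \<and> mrel X (x \<bullet> \<S> k) (x \<bullet> k)"
      using two[of \<zero>] two[of "\<S> \<zero>"] two[of "\<S> (\<S> \<zero>)"] by (auto simp: *)
    moreover have "n \<in> N" "n \<ominus> g \<bullet> x = \<zero>" if "n \<in> {\<zero>, \<S> \<zero>}" for n using that x g_eq by auto
    ultimately show "\<exists>n\<in>N. \<exists>k\<in>N. n \<ominus> g \<bullet> x = \<zero> \<and> k \<ominus> g \<bullet> x = \<zero> \<and>
        mrel X (x \<bullet> n) (x \<bullet> \<S> n) \<and> mrel X (x \<bullet> \<S> k) (x \<bullet> k)" by blast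
  qed
  ultimately obtain a b where ab: "a \<in> N" "b \<in> N" "\<Phi> \<bullet> X \<bullet> g = mpair a b"
    "\<And>m. m \<in> N \<Longrightarrow> mrel X m m \<Longrightarrow> mrel X m b"
    using \<Phi> X g unfolding mUADS2_def mends_def by blast
  have "mrel X (\<S> c) b" using ab(4) c(1) rel by simp
  then have "b = \<S> c" using rel ab(2) c(1) by simp
  then show ?thesis using L_pair ab c(2) by simp
qed

subsection \<open>From \<open>\<mu>\<close> to \<open>\<Phi>\<close>\<close>

text \<open>Iteration of a type-1 function at a number needs only the type-0 recursor, with a step
  that disregards the index.\<close>

lemma ex_iterate:
  assumes H: "H \<in> Dom Tp1" and y: "y \<in> N"
  obtains x where "x \<in> Dom Tp1" "x \<bullet> \<zero> = y" "\<And>n. n \<in> N \<Longrightarrow> x \<bullet> \<S> n = H \<bullet> (x \<bullet> n)"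
proof -
  let ?h = "(''h'', Tp1)"
  define z where "z = tval (e0(?h := H)) [] (step (FVar ?h \<cdot> r_var))"
  have v: "valid (e0(?h := H))" using H valid_e0 by (intro valid_upd) auto
  have z: "z \<in> Dom (Tp0 \<rightarrow> Tp0 \<rightarrow> Tp0)" unfolding z_def using v by (intro step_Dom) auto
  have z_eq: "z \<bullet> r \<bullet> i = H \<bullet> r" if "r \<in> N" "i \<in> N" for r i
    using tval_step[of "FVar ?h \<cdot> r_var", OF _ v that] by (simp add: z_def)
  have "repr Tp0 Tp0 (\<lambda>n. cn R0 \<bullet> n \<bullet> y \<bullet> z)" by (intro repr_R0 repr_id repr_const z y)
  then obtain x where x: "x \<in> Dom Tp1" "\<And>n. n \<in> N \<Longrightarrow> x \<bullet> n = cn R0 \<bullet> n \<bullet> y \<bullet> z"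
    unfolding repr_def by blast
  show thesis
    using x y z by (intro that[of x]) (simp_all add: R0_Zero_ap R0_Sc_ap z_eq R0_N)
qed

text \<open>\<open>L\<close> is a characteristic function with nonzero meaning true, while
  \<open>G\<close> and \<open>K\<close> signal by zero, as \<mu> searches for zeros: zeros of
  \<open>G \<bullet> a\<close> are field elements not above \<open>a\<close>, zeros of
  \<open>K\<close> are least elements. Taking \<open>L\<close> to be the reversed order gives
  greatest elements.\<close>

lemma least_element:
  assumes \<mu>: "\<mu> \<in> Dom Tp2" "mmu \<mu>" and L: "L \<in> Dom (Tp0 \<rightarrow> Tp0 \<rightarrow> Tp0)"
    and G: "G \<in> Dom (Tp0 \<rightarrow> Tp1)"
    and G_eq: "\<And>a m. a \<in> N \<Longrightarrow> m \<in> N \<Longrightarrow>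
      G \<bullet> a \<bullet> m = (if L \<bullet> m \<bullet> m = \<zero> then \<S> \<zero> else if L \<bullet> a \<bullet> m = \<zero> then \<zero> else \<S> \<zero>)"
    and K: "K \<in> Dom Tp1"
    and K_eq: "\<And>a. a \<in> N \<Longrightarrow>
      K \<bullet> a = (if L \<bullet> a \<bullet> a = \<zero> then \<S> \<zero> else if G \<bullet> a \<bullet> (\<mu> \<bullet> (G \<bullet> a)) = \<zero> then \<S> \<zero> else \<zero>)"
    and no_descent: "\<And>x. x \<in> Dom Tp1 \<Longrightarrow> (\<And>i. i \<in> N \<Longrightarrow> L \<bullet> (x \<bullet> i) \<bullet> (x \<bullet> i) \<noteq> \<zero>) \<Longrightarrow>
      \<exists>n\<in>N. L \<bullet> (x \<bullet> n) \<bullet> (x \<bullet> \<S> n) \<noteq> \<zero>"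
    and m: "m \<in> N" "L \<bullet> m \<bullet> m \<noteq> \<zero>"
  shows "L \<bullet> (\<mu> \<bullet> K) \<bullet> m \<noteq> \<zero>"
proof -
  have G_Dom: "G \<bullet> a \<in> Dom Tp1" if "a \<in> N" for a using ap_Dom[OF G that] .
  have \<mu>_N: "\<mu> \<bullet> F \<in> N" if "F \<in> Dom Tp1" for F using ap_Dom[OF \<mu>(1) that] .
  have \<mu>_eq: "F \<bullet> (\<mu> \<bullet> F) = \<zero>" if "F \<in> Dom Tp1" "n \<in> N" "F \<bullet> n = \<zero>" for F n
    using \<mu>(2) that unfolding mmu_def by blast
  have "\<exists>a\<in>N. K \<bullet> a = \<zero>"
  proof (rule ccontr)
    assume none: "\<not> (\<exists>a\<in>N. K \<bullet> a = \<zero>)"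
    have smaller: "L \<bullet> (\<mu> \<bullet> (G \<bullet> a)) \<bullet> (\<mu> \<bullet> (G \<bullet> a)) \<noteq> \<zero> \<and> L \<bullet> a \<bullet> (\<mu> \<bullet> (G \<bullet> a)) = \<zero>"
      if a: "a \<in> N" "L \<bullet> a \<bullet> a \<noteq> \<zero>" for a
    proof -
      have "K \<bullet> a \<noteq> \<zero>" using none a by blast
      then have "G \<bullet> a \<bullet> (\<mu> \<bullet> (G \<bullet> a)) = \<zero>" using a K_eq by (auto split: if_splits)
      then show ?thesis using G_eq[of a "\<mu> \<bullet> (G \<bullet> a)"] a G_Dom \<mu>_N by (auto split: if_splits)
    qed
    have "repr Tp0 Tp0 (\<lambda>a. \<mu> \<bullet> (G \<bullet> a))" by (intro repr_ap1[OF \<mu>(1)] repr_ap1[OF G] repr_id)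
    then obtain H where H: "H \<in> Dom Tp1" "\<And>a. a \<in> N \<Longrightarrow> H \<bullet> a = \<mu> \<bullet> (G \<bullet> a)" unfolding repr_def by blast
    obtain x where x: "x \<in> Dom Tp1" "x \<bullet> \<zero> = m" "\<And>n. n \<in> N \<Longrightarrow> x \<bullet> \<S> n = H \<bullet> (x \<bullet> n)"
      using ex_iterate[OF H(1) m(1)] by blast
    \<comment> \<open>The sequence starts at the given field element \<open>m\<close>. Staying in
      the field is a negated equation with parameters, hence within the reach of quantifier-free
      induction.\<close>
    have field: "L \<bullet> (x \<bullet> i) \<bullet> (x \<bullet> i) \<noteq> \<zero>" if "i \<in> N" for i
      using that
    proof (induction i rule: induct0)
      case qfp
      show ?case
        by (intro qfp_not qfp_eq repr_ap[OF repr_ap1[OF L]] repr_ap1[OF x(1)] repr_id repr_const Zero_N)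
    next
      case (S i)
      then show ?case using smaller[of "x \<bullet> i"] x H by simp
    qed (use m x in simp)
    then obtain n where n: "n \<in> N" "L \<bullet> (x \<bullet> n) \<bullet> (x \<bullet> \<S> n) \<noteq> \<zero>" using no_descent x by blast
    then show False using smaller[of "x \<bullet> n"] field x H by simp
  qed
  then have "K \<bullet> (\<mu> \<bullet> K) = \<zero>" using \<mu>_eq K by blast
  moreover have N: "\<mu> \<bullet> K \<in> N" using K \<mu>_N by blast
  ultimately have "G \<bullet> (\<mu> \<bullet> K) \<bullet> (\<mu> \<bullet> (G \<bullet> (\<mu> \<bullet> K))) \<noteq> \<zero>"
    using K_eq[OF N] by (auto split: if_splits)
  then have "G \<bullet> (\<mu> \<bullet> K) \<bullet> m \<noteq> \<zero>" using \<mu>_eq[OF G_Dom[OF N] m(1)] by blast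
  then show ?thesis using G_eq[OF N m(1)] m(2) by auto
qed

end

subsection \<open>The realising terms\<close>

abbreviation f_var :: tm where "f_var \<equiv> FVar (''f'', Tp1)"
abbreviation p_var :: tm where "p_var \<equiv> FVar (v0 ''p'')"

definition first_zero_tm :: "tm \<Rightarrow> tm" where
  "first_zero_tm n = R0 \<cdot> n \<cdot> Zero \<cdot> step (ifz (f_var \<cdot> r_var) r_var (Sc \<cdot> i_var))"

definition eq_tm :: "tm \<Rightarrow> tm \<Rightarrow> tm" where
  "eq_tm s t = add (monus s t) (monus t s)"

text \<open>
  The order on \<open>{0, c + 1}\<close> with \<open>0 < c + 1\<close> if \<open>c\<close> is the first zero of \<open>f\<close>, and on \<open>{0}\<close> if
  \<open>f\<close> has no zero.
\<close>

definition order_tm :: tm where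
  "order_tm = lam (v0 ''p'') (let c = first_zero_tm p_var in
     ifz (eq_tm p_var (pair Zero Zero)) One
      (ifz (f_var \<cdot> c)
        (ifz (eq_tm p_var (pair Zero (Sc \<cdot> c))) One
          (ifz (eq_tm p_var (pair (Sc \<cdot> c) (Sc \<cdot> c))) One Zero))
        Zero))"

text \<open>The constant functional 1 is passed as \<open>g\<close>, and the returned pair code
  itself bounds the search.\<close>

definition mu_tm :: tm where
  "mu_tm = lam var_Phi (lam (''f'', Tp1)
     (first_zero_tm (FVar var_Phi \<cdot> order_tm \<cdot> (CK Tp0 Tp1 \<cdot> One))))"

abbreviation a_var :: tm where "a_var \<equiv> FVar (v0 ''a'')"
abbreviation m_var :: tm where "m_var \<equiv> FVar (v0 ''m'')"
abbreviation X_var :: tm where "X_var \<equiv> FVar (''X'', Tp1)"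

text \<open>Zero at \<open>m\<close> means that \<open>m\<close> is a field element refuting the
  minimality of \<open>a\<close>; this lets \<mu> look for such an \<open>m\<close>.\<close>

definition not_below_tm :: "tm \<Rightarrow> tm" where
  "not_below_tm l = lam (v0 ''a'') (lam (v0 ''m'')
     (ifz (l \<cdot> m_var \<cdot> m_var) One (ifz (l \<cdot> a_var \<cdot> m_var) Zero One)))"

definition is_least_tm :: "tm \<Rightarrow> tm" where
  "is_least_tm l = lam (v0 ''a'') (ifz (l \<cdot> a_var \<cdot> a_var) One
     (ifz (not_below_tm l \<cdot> a_var \<cdot> (FVar var_mu \<cdot> (not_below_tm l \<cdot> a_var))) One Zero))"

definition le_tm :: tm where
  "le_tm = lam (v0 ''a'') (lam (v0 ''m'') (X_var \<cdot> pair a_var m_var))"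

definition ge_tm :: tm where
  "ge_tm = lam (v0 ''a'') (lam (v0 ''m'') (X_var \<cdot> pair m_var a_var))"

definition Phi_tm :: tm where
  "Phi_tm = lam var_mu (lam (''X'', Tp1) (lam (''g'', Tp2)
     (pair (FVar var_mu \<cdot> is_least_tm le_tm) (FVar var_mu \<cdot> is_least_tm ge_tm))))"

lemma has_ty_first_zero_tm [simp]: "has_ty [] n Tp0 \<Longrightarrow> has_ty [] (first_zero_tm n) b \<longleftrightarrow> b = Tp0"
  by (auto simp: first_zero_tm_def has_ty_step)

lemma has_ty_lam2:
  "has_ty [] t c \<Longrightarrow> has_ty [] (lam v (lam w t)) (snd v \<rightarrow> snd w \<rightarrow> c)"
  by (intro has_ty_lam)

lemma has_ty_order_tm: "has_ty [] order_tm Tp1"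
  using has_ty_lam[of _ Tp0 "v0 ''p''"] by (simp add: order_tm_def Let_def eq_tm_def)

lemma has_ty_mu_tm: "has_ty [] mu_tm (snd var_Phi \<rightarrow> Tp2)"
  unfolding mu_tm_def using has_ty_order_tm
  by (intro has_ty_lam2[of _ Tp0 var_Phi "(''f'', Tp1)", simplified]) (auto simp: var_Phi_def)

lemma fv_mu_tm: "fv_tm mu_tm = {}"
  by (auto simp: mu_tm_def order_tm_def first_zero_tm_def eq_tm_def Let_def)

lemma has_ty_not_below_tm:
  "has_ty [] l (Tp0 \<rightarrow> Tp0 \<rightarrow> Tp0) \<Longrightarrow> has_ty [] (not_below_tm l) (Tp0 \<rightarrow> Tp1)"
  unfolding not_below_tm_def by (intro has_ty_lam2[of _ Tp0 "v0 ''a''" "v0 ''m''", simplified]) auto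

lemma has_ty_is_least_tm:
  "has_ty [] l (Tp0 \<rightarrow> Tp0 \<rightarrow> Tp0) \<Longrightarrow> has_ty [] (is_least_tm l) Tp1"
  unfolding is_least_tm_def using has_ty_not_below_tm[of l]
  by (intro has_ty_lam[of _ Tp0 "v0 ''a''", simplified]) (auto simp: var_mu_def)

lemma has_ty_le_tm: "has_ty [] le_tm (Tp0 \<rightarrow> Tp0 \<rightarrow> Tp0)" "has_ty [] ge_tm (Tp0 \<rightarrow> Tp0 \<rightarrow> Tp0)"
  unfolding le_tm_def ge_tm_def by (intro has_ty_lam2[of _ Tp0 "v0 ''a''" "v0 ''m''", simplified]; simp)+

lemma has_ty_Phi_tm: "has_ty [] Phi_tm (Tp2 \<rightarrow> snd var_Phi)"
  unfolding Phi_tm_def using has_ty_is_least_tm[OF has_ty_le_tm(1)] has_ty_is_least_tm[OF has_ty_le_tm(2)]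
  using has_ty_lam[of _ Tp0 "(''g'', Tp2)"] has_ty_lam2[of _ "Tp2 \<rightarrow> Tp0" var_mu "(''X'', Tp1)"]
  by (auto simp: var_Phi_def var_mu_def)

lemma fv_Phi_tm: "fv_tm Phi_tm = {}"
  by (auto simp: Phi_tm_def is_least_tm_def not_below_tm_def le_tm_def ge_tm_def)

context model
begin

lemma tval_lam2:
  assumes "has_ty [] t c" "valid e" "x \<in> Dom (snd v)" "y \<in> Dom (snd w)"
  shows "tval e [] (lam v (lam w t)) \<bullet> x \<bullet> y = tval (e(v := x, w := y)) [] t"
  using assms tval_lam[of "lam w t" "snd w \<rightarrow> c" e x v] tval_lam[of t c "e(v := x)" y w]
  by (simp add: has_ty_lam valid_upd)

lemma tval_eq_tm:
  "tval e D s \<in> N \<Longrightarrow> tval e D t \<in> N \<Longrightarrow> tval e D (eq_tm s t) = \<zero> \<longleftrightarrow> tval e D s = tval e D t"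
  "tval e D s \<in> N \<Longrightarrow> tval e D t \<in> N \<Longrightarrow> tval e D (eq_tm s t) \<in> N"
  by (simp_all add: eq_tm_def eq_test)

lemma mmu_mu_tm:
  assumes v: "valid e" and \<Phi>: "\<Phi> \<in> Dom (snd var_Phi)" "mUADS2 \<Phi>"
  shows "mmu (tval e [] mu_tm \<bullet> \<Phi>)"
  unfolding mmu_def
proof (intro ballI impI)
  fix f assume f: "f \<in> Dom Tp1" and "\<exists>n\<in>N. f \<bullet> n = \<zero>"
  then obtain n where n: "n \<in> N" "f \<bullet> n = \<zero>" by blast
  let ?e = "e(var_Phi := \<Phi>, (''f'', Tp1) := f)"
  have v': "valid ?e" using v \<Phi>(1) f by (intro valid_upd) auto
  \<comment> \<open>This step contains \<open>f\<close> as a parameter, so it is evaluated under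
    \<open>?e\<close> and handled apart from the closed steps of \<open>tval_recur\<close>.\<close>
  define z where "z = tval ?e [] (step (ifz (f_var \<cdot> r_var) r_var (Sc \<cdot> i_var)))"
  have z: "z \<in> Dom (Tp0 \<rightarrow> Tp0 \<rightarrow> Tp0)" unfolding z_def using v' by (intro step_Dom) auto
  have z_eq: "z \<bullet> r \<bullet> i = (if f \<bullet> r = \<zero> then r else \<S> i)" if "r \<in> N" "i \<in> N" for r i
    using tval_step[of "ifz (f_var \<cdot> r_var) r_var (Sc \<cdot> i_var)", OF _ v' that] f that
    by (simp add: z_def)
  let ?L = "\<lambda>n. cn R0 \<bullet> n \<bullet> \<zero> \<bullet> z"
  have L_N: "?L p \<in> N" if "p \<in> N" for p using that z by (intro R0_N) auto
  let ?X = "tval ?e [] order_tm"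
  have X: "?X \<in> Dom Tp1" using has_ty_order_tm v' by (intro tval_Dom)
  have X_eq: "?X \<bullet> p = (if p = mpair \<zero> \<zero> \<or>
      f \<bullet> ?L p = \<zero> \<and> (p = mpair \<zero> (\<S> (?L p)) \<or> p = mpair (\<S> (?L p)) (\<S> (?L p))) then \<S> \<zero> else \<zero>)"
    if p: "p \<in> N" for p
  proof -
    have L: "tval (?e(v0 ''p'' := p)) [] (first_zero_tm p_var) = ?L p"
      by (simp add: first_zero_tm_def z_def)
    have "?X \<bullet> p = tval (?e(v0 ''p'' := p)) [] (let c = first_zero_tm p_var in
     ifz (eq_tm p_var (pair Zero Zero)) One
      (ifz (f_var \<cdot> c)
        (ifz (eq_tm p_var (pair Zero (Sc \<cdot> c))) One
          (ifz (eq_tm p_var (pair (Sc \<cdot> c) (Sc \<cdot> c))) One Zero))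
        Zero))"
      unfolding order_tm_def using v' p
      by (intro tval_lam[where b = Tp0]) (auto simp: Let_def eq_tm_def)
    then show ?thesis using p L_N[OF p] f L
      by (simp add: Let_def tval_eq_tm)
  qed
  let ?g = "cn (CK Tp0 Tp1) \<bullet> \<S> \<zero>"
  have g: "?g \<in> Dom Tp2" using CK_Dom ap_Dom by (meson S_N Zero_N)
  have g_eq: "?g \<bullet> x = \<S> \<zero>" if "x \<in> Dom Tp1" for x using that by (simp add: CK_ap)
  have "tval e [] mu_tm \<bullet> \<Phi> \<bullet> f = tval ?e [] (first_zero_tm (FVar var_Phi \<cdot> order_tm \<cdot> (CK Tp0 Tp1 \<cdot> One)))"
    unfolding mu_tm_def using v \<Phi>(1) f has_ty_order_tm
    by (intro tval_lam2[where c = Tp0]) (auto simp: var_Phi_def)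
  also have "\<dots> = ?L (\<Phi> \<bullet> ?X \<bullet> ?g)"
    by (simp add: first_zero_tm_def z_def var_Phi_def)
  finally show "f \<bullet> (tval e [] mu_tm \<bullet> \<Phi> \<bullet> f) = \<zero>"
    using mu_from_Phi[OF \<Phi>(2) f z z_eq X X_eq g g_eq n] by simp
qed

text \<open>Freshness of the names \<open>a\<close> and \<open>m\<close> keeps the abstractions
  inside \<open>is_least_tm\<close> from capturing variables of \<open>l\<close>; the order
  \<open>X\<close> stays available as a parameter.\<close>

lemma least_element_tm:
  assumes v: "valid e" and \<mu>: "mmu (e var_mu)"
    and l: "has_ty [] l (Tp0 \<rightarrow> Tp0 \<rightarrow> Tp0)" "v0 ''a'' \<notin> fv_tm l" "v0 ''m'' \<notin> fv_tm l"
    and no_descent: "\<And>x. x \<in> Dom Tp1 \<Longrightarrow> (\<And>i. i \<in> N \<Longrightarrow> tval e [] l \<bullet> (x \<bullet> i) \<bullet> (x \<bullet> i) \<noteq> \<zero>) \<Longrightarrow>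
      \<exists>n\<in>N. tval e [] l \<bullet> (x \<bullet> n) \<bullet> (x \<bullet> \<S> n) \<noteq> \<zero>"
    and m: "m \<in> N" "tval e [] l \<bullet> m \<bullet> m \<noteq> \<zero>"
  shows "tval e [] l \<bullet> (e var_mu \<bullet> tval e [] (is_least_tm l)) \<bullet> m \<noteq> \<zero>"
proof (rule least_element[OF _ \<mu> _ _ _ _ _ no_descent m])
  let ?L = "tval e [] l" and ?G = "tval e [] (not_below_tm l)"
  show "e var_mu \<in> Dom Tp2" using v by (simp add: valid_def var_mu_def del: split_paired_All) (metis snd_conv)
  then have \<mu>_N: "e var_mu \<bullet> F \<in> N" if "F \<in> Dom Tp1" for F using that ap_Dom by blast
  show L: "?L \<in> Dom (Tp0 \<rightarrow> Tp0 \<rightarrow> Tp0)" using l v by (intro tval_Dom)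
  have L_N: "?L \<bullet> a \<bullet> b \<in> N" if "a \<in> N" "b \<in> N" for a b using ap_Dom[OF ap_Dom[OF L that(1)] that(2)] .
  show G: "?G \<in> Dom (Tp0 \<rightarrow> Tp1)" using has_ty_not_below_tm l v by (intro tval_Dom) auto
  have G_Dom: "?G \<bullet> a \<in> Dom Tp1" if "a \<in> N" for a using ap_Dom[OF G that] .
  show "tval e [] (is_least_tm l) \<in> Dom Tp1" using has_ty_is_least_tm l v by (intro tval_Dom) auto
  show "?G \<bullet> a \<bullet> b = (if ?L \<bullet> b \<bullet> b = \<zero> then \<S> \<zero> else if ?L \<bullet> a \<bullet> b = \<zero> then \<zero> else \<S> \<zero>)"
    if ab: "a \<in> N" "b \<in> N" for a b
  proof -
    have "?G \<bullet> a \<bullet> b = tval (e(v0 ''a'' := a, v0 ''m'' := b)) []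
        (ifz (l \<cdot> m_var \<cdot> m_var) One (ifz (l \<cdot> a_var \<cdot> m_var) Zero One))"
      unfolding not_below_tm_def using v ab l by (intro tval_lam2[where c = Tp0]) auto
    then show ?thesis using l ab by (simp add: L_N)
  qed
  show "tval e [] (is_least_tm l) \<bullet> a = (if ?L \<bullet> a \<bullet> a = \<zero> then \<S> \<zero>
      else if ?G \<bullet> a \<bullet> (e var_mu \<bullet> (?G \<bullet> a)) = \<zero> then \<S> \<zero> else \<zero>)" if a: "a \<in> N" for a
  proof -
    have "tval e [] (is_least_tm l) \<bullet> a = tval (e(v0 ''a'' := a)) [] (ifz (l \<cdot> a_var \<cdot> a_var) One
       (ifz (not_below_tm l \<cdot> a_var \<cdot> (FVar var_mu \<cdot> (not_below_tm l \<cdot> a_var))) One Zero))"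
      unfolding is_least_tm_def using v a l has_ty_not_below_tm
      by (intro tval_lam[where b = Tp0]) (auto simp: var_mu_def)
    moreover have "tval (e(v0 ''a'' := a)) [] (not_below_tm l) = ?G"
      using l by (intro tval_upd_fresh) (simp add: not_below_tm_def)
    ultimately show ?thesis using l a G_Dom \<mu>_N by (simp add: L_N var_mu_def)
  qed
qed

lemma mUADS2_Phi_tm:
  assumes v: "valid e" and \<mu>: "\<mu> \<in> Dom Tp2" "mmu \<mu>"
  shows "mUADS2 (tval e [] Phi_tm \<bullet> \<mu>)"
  unfolding mUADS2_def
proof (intro ballI impI)
  fix X g assume X: "X \<in> Dom Tp1" and g: "g \<in> Dom Tp2" and lin: "mlin X" and bounded: "mbounded X g"
  let ?e = "e(var_mu := \<mu>, (''X'', Tp1) := X, (''g'', Tp2) := g)"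
  have v': "valid ?e" using v \<mu> X g by (intro valid_upd) (auto simp: var_mu_def)
  have e_mu: "?e var_mu = \<mu>" by (simp add: var_mu_def)
  \<comment> \<open>Set values are 0 or 1, so being nonzero, the notion of truth in
    \<open>least_element\<close>, coincides with the relation.\<close>
  have X_neq: "X \<bullet> mpair s t \<noteq> \<zero> \<longleftrightarrow> mrel X s t" if "s \<in> N" "t \<in> N" for s t
    using lin that unfolding mlin_def mrel_def by (metis S_neq(1) Zero_N arith_N(5))
  have le: "tval ?e [] le_tm \<bullet> s \<bullet> t = X \<bullet> mpair s t" if "s \<in> N" "t \<in> N" for s t
    unfolding le_tm_def using v' that by (subst tval_lam2[where c = Tp0]) auto
  have ge: "tval ?e [] ge_tm \<bullet> s \<bullet> t = X \<bullet> mpair t s" if "s \<in> N" "t \<in> N" for s t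
    unfolding ge_tm_def using v' that by (subst tval_lam2[where c = Tp0]) auto
  let ?a = "\<mu> \<bullet> tval ?e [] (is_least_tm le_tm)" and ?b = "\<mu> \<bullet> tval ?e [] (is_least_tm ge_tm)"
  have ab: "?a \<in> N" "?b \<in> N"
    using has_ty_is_least_tm has_ty_le_tm v' by (auto intro!: ap_Dom[OF \<mu>(1)] tval_Dom)
  have "tval e [] Phi_tm \<bullet> \<mu> \<bullet> X \<bullet> g = tval (e(var_mu := \<mu>, (''X'', Tp1) := X)) [] (lam (''g'', Tp2)
     (pair (FVar var_mu \<cdot> is_least_tm le_tm) (FVar var_mu \<cdot> is_least_tm ge_tm))) \<bullet> g"
    unfolding Phi_tm_def using v \<mu> X has_ty_is_least_tm has_ty_le_tm
    by (subst tval_lam2[where c = "Tp2 \<rightarrow> Tp0"])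
      (auto simp: var_mu_def intro!: has_ty_lam[of _ Tp0 "(''g'', Tp2)", simplified])
  also have "\<dots> = mpair ?a ?b"
    using v \<mu> X g has_ty_is_least_tm has_ty_le_tm
    by (subst tval_lam[where b = Tp0]) (auto simp: var_mu_def intro!: valid_upd)
  finally have val: "tval e [] Phi_tm \<bullet> \<mu> \<bullet> X \<bullet> g = mpair ?a ?b" .
  have "mrel X ?a m \<and> mrel X m ?b" if m: "m \<in> N" "mrel X m m" for m
  proof
    have "tval ?e [] le_tm \<bullet> (?e var_mu \<bullet> tval ?e [] (is_least_tm le_tm)) \<bullet> m \<noteq> \<zero>"
    proof (rule least_element_tm[OF v' _ has_ty_le_tm(1) _ _ _ m(1)])
      fix x assume x: "x \<in> Dom Tp1" and "\<And>i. i \<in> N \<Longrightarrow> tval ?e [] le_tm \<bullet> (x \<bullet> i) \<bullet> (x \<bullet> i) \<noteq> \<zero>"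
      then have "\<forall>i\<in>N. mrel X (x \<bullet> i) (x \<bullet> i)" using le X_neq by simp
      \<comment> \<open>The weak ascent among the two promised steps excludes an infinite descent;
        the weak descent does the same below for the reversed order.\<close>
      then obtain n where "n \<in> N" "mrel X (x \<bullet> n) (x \<bullet> \<S> n)"
        using bounded x unfolding mbounded_def by blast
      then show "\<exists>n\<in>N. tval ?e [] le_tm \<bullet> (x \<bullet> n) \<bullet> (x \<bullet> \<S> n) \<noteq> \<zero>" using le X_neq x by auto
    qed (use m le X_neq \<mu> e_mu in \<open>auto simp: le_tm_def\<close>)
    then show "mrel X ?a m" unfolding e_mu using le X_neq ab m by simp
    have "tval ?e [] ge_tm \<bullet> (?e var_mu \<bullet> tval ?e [] (is_least_tm ge_tm)) \<bullet> m \<noteq> \<zero>"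
    proof (rule least_element_tm[OF v' _ has_ty_le_tm(2) _ _ _ m(1)])
      fix x assume x: "x \<in> Dom Tp1" and "\<And>i. i \<in> N \<Longrightarrow> tval ?e [] ge_tm \<bullet> (x \<bullet> i) \<bullet> (x \<bullet> i) \<noteq> \<zero>"
      then have "\<forall>i\<in>N. mrel X (x \<bullet> i) (x \<bullet> i)" using ge X_neq by simp
      then obtain k where "k \<in> N" "mrel X (x \<bullet> \<S> k) (x \<bullet> k)"
        using bounded x unfolding mbounded_def by blast
      then show "\<exists>n\<in>N. tval ?e [] ge_tm \<bullet> (x \<bullet> n) \<bullet> (x \<bullet> \<S> n) \<noteq> \<zero>" using ge X_neq x by auto
    qed (use m ge X_neq \<mu> e_mu in \<open>auto simp: ge_tm_def\<close>)
    then show "mrel X m ?b" unfolding e_mu using ge X_neq ab m by simp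
  qed
  then show "mends X (tval e [] Phi_tm \<bullet> \<mu> \<bullet> X \<bullet> g)"
    unfolding mends_def val using ab by blast
qed

end

section \<open>The explicit equivalence\<close>

text \<open>Conjunction abbreviates a negated implication; refuting that implication is done in
  \<open>ded\<close>, where theorems remain available under hypotheses.\<close>

lemma prov_Con:
  assumes "T \<turnstile> p" "T \<turnstile> q"
  shows "T \<turnstile> p \<^bold>\<and> q"
proof -
  have wf: "wff [] (p \<^bold>\<longrightarrow> \<^bold>\<not> q)" using assms[THEN deriv_wff] by simp
  then have "ded T {p \<^bold>\<longrightarrow> \<^bold>\<not> q} (p \<^bold>\<longrightarrow> \<^bold>\<not> q)" by (intro ded.mem) auto
  then have "ded T {p \<^bold>\<longrightarrow> \<^bold>\<not> q} Bot" using assms[THEN ded.prov] ded.mp by blast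
  then show ?thesis using wf by (intro ded_empty ded_deduct)
qed

lemma RCA0_omega_complete:
  assumes "wff [] p"
    and "\<And>(Dom :: ty \<Rightarrow> tm set set) ap cn e. model Dom ap cn \<Longrightarrow>
      model.valid Dom e \<Longrightarrow> applicative.sat Dom ap cn e [] p"
  shows "RCA0_omega \<turnstile> p"
proof (rule completeness)
  fix Dom :: "ty \<Rightarrow> tm set set" and ap cn and e :: "var \<Rightarrow> tm set"
  assume M: "model Dom ap cn" and "\<And>v. e v \<in> Dom (snd v)"
  then have "model.valid Dom e" using model.valid_def[OF M] by blast
  with M show "applicative.sat Dom ap cn e [] p" by (rule assms(2))
qed (use assms(1) in \<open>auto simp: RCA0_omega_def\<close>)

text \<open>One semantic condition serves both provability claims: the value of the realising term
  lies in the domain of \<open>Q\<close> and so also witnesses the plain existential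
  statement.\<close>

lemma explicit_impI:
  assumes A: "wff [] A" and B: "wff [] B" and t: "has_ty [] t (snd P \<rightarrow> snd Q)" "fv_tm t = {}"
    and realises: "\<And>(Dom :: ty \<Rightarrow> tm set set) ap cn e x. model Dom ap cn \<Longrightarrow>
      model.valid Dom e \<Longrightarrow> x \<in> Dom (snd P) \<Longrightarrow> applicative.sat Dom ap cn (e(P := x)) [] A \<Longrightarrow>
      applicative.sat Dom ap cn (e(Q := ap (applicative.tval ap cn e [] t) x)) [] B"
  shows "explicit_imp RCA0_omega P A X E Q B"
proof -
  have "RCA0_omega \<turnstile> (\<^bold>\<exists>P. A) \<^bold>\<longrightarrow> (\<^bold>\<exists>Q. B)"
  proof (rule RCA0_omega_complete)
    fix Dom :: "ty \<Rightarrow> tm set set" and ap cn and e :: "var \<Rightarrow> tm set"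
    assume M: "model Dom ap cn" and v: "model.valid Dom e"
    interpret model Dom ap cn by (rule M)
    have "ap (tval e [] t) x \<in> Dom (snd Q)" if "x \<in> Dom (snd P)" for x
      using ap_Dom[OF tval_Dom[OF t(1) v] that] .
    then show "sat e [] ((\<^bold>\<exists>P. A) \<^bold>\<longrightarrow> (\<^bold>\<exists>Q. B))"
      using realises[OF M v] by (auto simp: sat_ex_var A B)
  qed (use A B in \<open>simp add: wff_ex_var\<close>)
  moreover have "RCA0_omega \<turnstile> \<^bold>\<forall>P. A \<^bold>\<longrightarrow> subst B Q (t \<cdot> FVar P)"
  proof (rule RCA0_omega_complete)
    have tP: "has_ty [] (t \<cdot> FVar P) (snd Q)" using t by auto
    then have wf: "wff [] (A \<^bold>\<longrightarrow> subst B Q (t \<cdot> FVar P))" using A B wff_subst by simp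
    then show "wff [] (\<^bold>\<forall>P. A \<^bold>\<longrightarrow> subst B Q (t \<cdot> FVar P))" by (rule wff_all_var)
    fix Dom :: "ty \<Rightarrow> tm set set" and ap cn and e :: "var \<Rightarrow> tm set"
    assume M: "model Dom ap cn" and v: "model.valid Dom e"
    interpret model Dom ap cn by (rule M)
    \<comment> \<open>The semantic condition is used with the updated assignment, because the
      substituted term is evaluated where \<open>P\<close> already denotes \<open>x\<close>.\<close>
    have "sat (e(P := x)) [] (subst B Q (t \<cdot> FVar P))"
      if x: "x \<in> Dom (snd P)" and "sat (e(P := x)) [] A" for x
      using realises[OF M valid_upd[OF v x] x] that(2) by (simp add: sat_subst[OF B tP])
    then show "sat e [] (\<^bold>\<forall>P. A \<^bold>\<longrightarrow> subst B Q (t \<cdot> FVar P))"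
      by (simp add: sat_all_var[OF wf])
  qed
  ultimately show ?thesis unfolding explicit_imp_def using t by blast
qed

theorem theorem6p2:
  shows "explicit_equiv RCA0_omega
    var_Phi UADS2_spec var_Xi_Phi UADS2_ext
    var_mu mu_spec var_Xi_mu mu_ext"
proof -
  have 1: "explicit_imp RCA0_omega var_Phi UADS2_spec X E var_mu mu_spec" for X E
  proof (rule explicit_impI[OF wff_UADS2_spec wff_mu_spec _ fv_mu_tm])
    show "has_ty [] mu_tm (snd var_Phi \<rightarrow> snd var_mu)"
      using has_ty_mu_tm by (simp add: var_mu_def)
    fix Dom :: "ty \<Rightarrow> tm set set" and ap cn and e :: "var \<Rightarrow> tm set" and x
    assume M: "model Dom ap cn" and *: "model.valid Dom e" "x \<in> Dom (snd var_Phi)"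
      "applicative.sat Dom ap cn (e(var_Phi := x)) [] UADS2_spec"
    interpret model Dom ap cn by (rule M)
    show "sat (e(var_mu := ap (tval e [] mu_tm) x)) [] mu_spec"
      using * mmu_mu_tm by (simp add: sat_UADS2_spec sat_mu_spec)
  qed
  have 2: "explicit_imp RCA0_omega var_mu mu_spec X E var_Phi UADS2_spec" for X E
  proof (rule explicit_impI[OF wff_mu_spec wff_UADS2_spec _ fv_Phi_tm])
    show "has_ty [] Phi_tm (snd var_mu \<rightarrow> snd var_Phi)"
      using has_ty_Phi_tm by (simp add: var_mu_def)
    fix Dom :: "ty \<Rightarrow> tm set set" and ap cn and e :: "var \<Rightarrow> tm set" and x
    assume M: "model Dom ap cn" and *: "model.valid Dom e" "x \<in> Dom (snd var_mu)"
      "applicative.sat Dom ap cn (e(var_mu := x)) [] mu_spec"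
    interpret model Dom ap cn by (rule M)
    have "x \<in> Dom Tp2" using *(2) by (simp add: var_mu_def)
    then show "sat (e(var_Phi := ap (tval e [] Phi_tm) x)) [] UADS2_spec"
      using * mUADS2_Phi_tm by (simp add: sat_UADS2_spec sat_mu_spec)
  qed
  show ?thesis
    unfolding explicit_equiv_def using 1 2 by (auto simp: explicit_imp_def intro!: prov_Con)
qed

end
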